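(* There exists an absolute constant $c$ with $0<c<1$ such that $$\limsup_{x\rightarrow\infty}\frac{T_c(x)}{\pi(x)}<\frac12,$$ where $T_c(x)=\#\{p\le x: p \text{ prime},\ P^+(p-1)\ge p^c\}$.
   Context: For an integer $n\ge 2$, $P^+(n)$ denotes the largest prime factor of $n$, and by convention $P^+(1)=1$. For real $x$, $\pi(x)$ denotes the number of primes $p\le x$. For a real number $c$ with $0<c<1$ and real $x$, $T_c(x)$ denotes the number of primes $p\le x$ such that $P^+(p-1)\ge p^c$. The limit superior is taken as the real variable $x$ tends to infinity. *)

theory Defs
  imports
    "HOL-Analysis.Analysis"
    "HOL-Computational_Algebra.Primes"
begin

(* The mathematical convention is P^+(1) = 1; the value at 0 is irrelevant. *)
definition largest_prime_factor :: "nat \<Rightarrow> nat" where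
  "largest_prime_factor n = (if n \<le> 1 then 1 else Max (prime_factors n))"

definition prime_count :: "real \<Rightarrow> nat" where
  "prime_count x = card {p::nat. prime p \<and> real p \<le> x}"

definition shifted_prime_count :: "real \<Rightarrow> real \<Rightarrow> nat" where
  "shifted_prime_count c x =
     card {p::nat. prime p \<and> real p \<le> x \<and>
                   real (largest_prime_factor (p - 1)) \<ge> real p powr c}"

end

theory Submission
  imports
    Defs
    "HOL-Number_Theory.Cong"
    "HOL-Real_Asymp.Real_Asymp"
begin

text \<open>
  If \<open>p \<le> x\<close> and the largest prime factor \<open>q\<close> of \<open>p - 1\<close> is at least \<open>p powr c\<close>, then \<open>p = m * q + 1\<close>
  with \<open>m \<le> x powr (1 - c)\<close>. For fixed \<open>m\<close> (even, up to trivial cases) Selberg's sieve bounds the number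
  of \<open>q \<le> x / m\<close> such that \<open>q\<close> and \<open>m * q + 1\<close> are both prime by a constant times
  \<open>(m / \<phi>(m)) * (x / m) / (ln x)\<^sup>2\<close>. As \<open>m / \<phi>(m)\<close> is bounded on average, summation over \<open>m\<close> gives at
  most a constant times \<open>(1 - c) * x / ln x\<close> primes, up to lower order terms. By Chebyshev's lower bound
  for the number of primes, which follows from \<open>Lcm {1..n} \<ge> 2 ^ (n - 1)\<close>, this is a small proportion
  of all primes once \<open>c\<close> is close to 1.
\<close>

section \<open>Selberg's sieve\<close>

text \<open>Losing a constant factor is harmless, since \<open>1 - c\<close> may be taken as small
  as desired; what may not be lost is the dependence on \<open>m\<close>. The ratio
  \<open>m / \<phi>(m)\<close> is unbounded, so the bound for a single \<open>m\<close> has to carry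
  it explicitly, and only the sum over \<open>m\<close> removes it. The delicate point is a lower
  bound of order \<open>(ln Y)\<^sup>2\<close> for the denominator of the sieve bound, a sum over
  squarefree integers whose local factor is about \<open>2 / p\<close> for primes not dividing
  \<open>m\<close>. Instead of Mertens-type estimates it rests on squaring: the sum of
  \<open>1 / \<phi>(s)\<close> over squarefree \<open>s \<le> Y\<close> is at least the harmonic
  sum, and its square is compared with the sieve sum up to \<open>Y\<^sup>2\<close>. With crude
  weights the sieve error is then \<open>Y ^ 12\<close>. Taking \<open>Y\<close> about
  \<open>x powr (1 / 40)\<close> makes this \<open>x powr (3 / 10)\<close> for each
  \<open>m\<close>, still negligible after adding up \<open>x powr (1 - c)\<close> of them when
  \<open>c\<close> is close to 1.\<close>

text \<open>The sets in between are \<open>L \<union> R\<close> with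
  \<open>R \<subseteq> T - L\<close>, so the sum expands a product of factors
  \<open>(-1) + 1\<close>, which vanishes unless \<open>T - L\<close> is empty. This is the Moebius
  inversion behind the weights.\<close>

lemma sum_minus_one_power_card_between:
  assumes "finite T" "L \<subseteq> T"
  shows "(\<Sum>S | L \<subseteq> S \<and> S \<subseteq> T. (-1) ^ card S) = (if L = T then (-1) ^ card T else (0::real))"
proof -
  have fin: "finite L" using assms finite_subset by blast
  have img: "{S. L \<subseteq> S \<and> S \<subseteq> T} = (\<union>) L ` Pow (T - L)"
  proof (intro equalityI subsetI)
    fix S assume "S \<in> {S. L \<subseteq> S \<and> S \<subseteq> T}"
    then have "S = L \<union> (S - L)" "S - L \<in> Pow (T - L)" by auto
    then show "S \<in> (\<union>) L ` Pow (T - L)" by blast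
  qed (use assms in auto)
  have inj: "inj_on ((\<union>) L) (Pow (T - L))" by (auto intro!: inj_onI)
  have "(\<Sum>S | L \<subseteq> S \<and> S \<subseteq> T. (-1) ^ card S) = (\<Sum>R\<in>Pow (T - L). (-1::real) ^ card (L \<union> R))"
    unfolding img by (simp add: sum.reindex[OF inj])
  also have "\<dots> = (\<Sum>R\<in>Pow (T - L). (-1) ^ card L * ((\<Prod>x\<in>R. -1) * (\<Prod>x\<in>(T - L) - R. 1)))"
  proof (rule sum.cong[OF refl])
    fix R assume R: "R \<in> Pow (T - L)"
    then have "finite R" using assms finite_subset by fastforce
    then have "card (L \<union> R) = card L + card R" using R fin by (intro card_Un_disjoint) auto
    then show "(-1::real) ^ card (L \<union> R) = (-1) ^ card L * ((\<Prod>x\<in>R. -1) * (\<Prod>x\<in>(T - L) - R. 1))"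
      by (simp add: power_add)
  qed
  also have "\<dots> = (-1) ^ card L * (\<Prod>x\<in>T - L. (-1::real) + 1)"
    using assms by (subst prod_add) (auto simp: sum_distrib_left)
  also have "\<dots> = (if L = T then (-1) ^ card T else 0)"
    using assms by (auto simp: prod_constant power_0_left card_0_eq)
  finally show ?thesis .
qed

lemma prod_one_plus_eq_sum_Pow:
  fixes f :: "'a \<Rightarrow> 'b::comm_ring_1"
  assumes "finite A"
  shows "(\<Prod>x\<in>A. 1 + f x) = (\<Sum>X\<in>Pow A. prod f X)"
  using prod_add[OF assms, of f "\<lambda>_. 1"] by (simp add: add.commute)

text \<open>
  Finite sets of primes play the role of squarefree integers: union is the least common multiple,
  intersection the greatest common divisor, and \<open>(-1) ^ card S\<close> the Moebius function. The choice of
  the weights diagonalises the quadratic form: with \<open>h p = 1 / g p\<close> it equals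
  \<open>\<Sum>L. (\<Prod>p\<in>L. h p) * (y L)\<^sup>2\<close>, where \<open>y L\<close> is the quantity evaluated in the step \<open>inner\<close>.
\<close>

lemma selberg_weights:
  fixes g :: "'a \<Rightarrow> real"
  assumes finD: "finite D" and finS: "\<And>S. S \<in> D \<Longrightarrow> finite S"
    and down: "\<And>S T. S \<in> D \<Longrightarrow> T \<subseteq> S \<Longrightarrow> T \<in> D" and ne: "{} \<in> D"
    and gpos: "\<And>S p. S \<in> D \<Longrightarrow> p \<in> S \<Longrightarrow> g p > 0"
  obtains w :: "'a set \<Rightarrow> real" where "w {} = 1"
    "\<And>S. S \<in> D \<Longrightarrow> \<bar>w S\<bar> \<le> (\<Prod>p\<in>S. 1 + g p)"
    "(\<Sum>S\<in>D. \<Sum>T\<in>D. w S * w T * (\<Prod>p\<in>S \<union> T. g p / (1 + g p))) = 1 / (\<Sum>S\<in>D. prod g S)"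
proof -
  define G where "G = (\<Sum>S\<in>D. prod g S)"
  define f where "f = (\<lambda>p. (1 + g p) / g p)"
  define up where "up = (\<lambda>S. \<Sum>L | L \<in> D \<and> S \<subseteq> L. prod g L)"
  define w where "w = (\<lambda>S. (-1) ^ card S * prod f S / G * up S)"
  have prod_pos': "prod g S > 0" if "S \<in> D" for S
    using gpos that by (intro prod_pos) auto
  have Gpos: "G > 0" unfolding G_def
    using prod_pos' ne finD by (intro sum_pos) auto
  have fpos: "f p > 0" if "S \<in> D" "p \<in> S" for S p
    using gpos[OF that] by (simp add: f_def)
  have prodf: "prod f S > 0" if "S \<in> D" for S
    using fpos that by (intro prod_pos) auto
  have inner: "(\<Sum>S | S \<in> D \<and> L \<subseteq> S. w S / prod f S) = (-1) ^ card L * prod g L / G"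
    if L: "L \<in> D" for L
  proof -
    have "(\<Sum>S | S \<in> D \<and> L \<subseteq> S. w S / prod f S)
        = (\<Sum>S | S \<in> D \<and> L \<subseteq> S. (-1) ^ card S / G * up S)"
    proof (intro sum.cong refl)
      fix S assume "S \<in> {S. S \<in> D \<and> L \<subseteq> S}"
      then have "prod f S > 0" using prodf by auto
      then show "w S / prod f S = (-1) ^ card S / G * up S" by (simp add: w_def)
    qed
    also have "\<dots> = (\<Sum>S\<in>{S\<in>D. L \<subseteq> S}. \<Sum>T\<in>{T\<in>D. S \<subseteq> T}. (-1) ^ card S * prod g T / G)"
      by (simp add: up_def sum_distrib_left)
    also have "\<dots> = (\<Sum>T\<in>D. \<Sum>S\<in>{S\<in>{S\<in>D. L \<subseteq> S}. S \<subseteq> T}. (-1) ^ card S * prod g T / G)"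
      using finD by (subst sum.swap_restrict) auto
    also have "\<dots> = (\<Sum>T\<in>D. if T = L then (-1) ^ card L * prod g L / G else 0)"
    proof (intro sum.cong refl)
      fix T assume T: "T \<in> D"
      have *: "{S\<in>{S\<in>D. L \<subseteq> S}. S \<subseteq> T} = {S. L \<subseteq> S \<and> S \<subseteq> T}"
        using T down by blast
      show "(\<Sum>S\<in>{S\<in>{S\<in>D. L \<subseteq> S}. S \<subseteq> T}. (-1) ^ card S * prod g T / G)
          = (if T = L then (-1) ^ card L * prod g L / G else 0)"
      proof (cases "L \<subseteq> T")
        case True
        have "(\<Sum>S | L \<subseteq> S \<and> S \<subseteq> T. (-1) ^ card S * prod g T / G)
            = (\<Sum>S | L \<subseteq> S \<and> S \<subseteq> T. (-1) ^ card S) * (prod g T / G)"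
          by (simp add: sum_distrib_right sum_divide_distrib)
        then show ?thesis unfolding *
          using sum_minus_one_power_card_between[OF finS[OF T] True] by auto
      next
        case False
        then have "{S. L \<subseteq> S \<and> S \<subseteq> T} = {}" "T \<noteq> L" by auto
        then show ?thesis unfolding * by (simp only: sum.empty if_False)
      qed
    qed
    also have "\<dots> = (-1) ^ card L * prod g L / G" using L finD by simp
    finally show ?thesis .
  qed
  have "w {} = 1"
  proof -
    have "{L. L \<in> D \<and> {} \<subseteq> L} = D" by auto
    then have "up {} = G" by (simp add: up_def G_def)
    then show ?thesis using Gpos by (simp add: w_def)
  qed
  moreover have "\<bar>w S\<bar> \<le> (\<Prod>p\<in>S. 1 + g p)" if S: "S \<in> D" for S
  proof -
    have up0: "up S \<ge> 0" unfolding up_def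
      using prod_pos' by (intro sum_nonneg) (auto intro: less_imp_le)
    \<comment> \<open>Pulling out \<open>prod g S\<close> leaves a sum over the sets
      \<open>L - S\<close>. They are distinct members of \<open>D\<close>, which is closed under
      subsets, so the sum is at most \<open>G\<close>.\<close>
    have "up S = (\<Sum>L | L \<in> D \<and> S \<subseteq> L. prod g S * prod g (L - S))"
      unfolding up_def
    proof (intro sum.cong refl)
      fix L assume L: "L \<in> {L. L \<in> D \<and> S \<subseteq> L}"
      then have "finite L" using finS by auto
      then show "prod g L = prod g S * prod g (L - S)"
        using L by (subst prod.subset_diff[of S L]) (auto simp: mult.commute)
    qed
    also have "\<dots> = prod g S * (\<Sum>L | L \<in> D \<and> S \<subseteq> L. prod g (L - S))"
      by (simp add: sum_distrib_left)
    also have "(\<Sum>L | L \<in> D \<and> S \<subseteq> L. prod g (L - S)) = sum (prod g) ((\<lambda>L. L - S) ` {L. L \<in> D \<and> S \<subseteq> L})"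
      by (subst sum.reindex) (auto intro!: inj_onI)
    also have "\<dots> \<le> G" unfolding G_def
      using finD prod_pos' down by (intro sum_mono2) (auto intro: less_imp_le)
    finally have upS: "up S \<le> prod g S * G" using prod_pos'[OF S] by simp
    have "\<bar>w S\<bar> = prod f S / G * up S"
      using up0 Gpos prodf[OF S] by (simp add: w_def abs_mult power_abs)
    also have "\<dots> \<le> prod f S / G * (prod g S * G)"
      using upS prodf[OF S] Gpos by (intro mult_left_mono) auto
    also have "\<dots> = prod f S * prod g S" using Gpos by simp
    also have "\<dots> = (\<Prod>p\<in>S. 1 + g p)"
      unfolding prod.distrib[symmetric]
    proof (intro prod.cong refl)
      fix p assume "p \<in> S"
      then have "g p > 0" using gpos S by blast
      then show "f p * g p = 1 + g p" by (simp add: f_def)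
    qed
    finally show ?thesis .
  qed
  moreover have "(\<Sum>S\<in>D. \<Sum>T\<in>D. w S * w T * (\<Prod>p\<in>S \<union> T. g p / (1 + g p))) = 1 / G"
  proof -
    have f_inv: "g p / (1 + g p) = 1 / f p" for p by (simp add: f_def)
    \<comment> \<open>The factor for \<open>S \<union> T\<close> couples the two sets. It is traded
      for \<open>prod f (S \<inter> T)\<close>, which, as \<open>f p = 1 + 1 / g p\<close>, expands
      into a sum over the sets \<open>L\<close> contained in both. For fixed \<open>L\<close> the
      summand separates into a term in \<open>S\<close> and a term in \<open>T\<close>.\<close>
    have step: "w S * w T * (\<Prod>p\<in>S \<union> T. g p / (1 + g p))
        = (\<Sum>L | L \<in> D \<and> L \<subseteq> S \<and> L \<subseteq> T. (w S / prod f S) * (w T / prod f T) / prod g L)"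
      if S: "S \<in> D" and T: "T \<in> D" for S T
    proof -
      have fin: "finite S" "finite T" using finS S T by auto
      have ST: "S \<inter> T \<in> D" using down S by blast
      have "(\<Sum>L | L \<in> D \<and> L \<subseteq> S \<and> L \<subseteq> T. 1 / prod g L) = (\<Sum>L\<in>Pow (S \<inter> T). \<Prod>p\<in>L. 1 / g p)"
        using down S by (intro sum.cong) (auto simp: prod_dividef)
      also have "\<dots> = (\<Prod>p\<in>S \<inter> T. 1 + 1 / g p)"
        using fin by (subst prod_one_plus_eq_sum_Pow) auto
      also have "\<dots> = prod f (S \<inter> T)"
        using gpos[OF S] by (intro prod.cong) (force simp: f_def field_simps)+
      finally have 1: "(\<Sum>L | L \<in> D \<and> L \<subseteq> S \<and> L \<subseteq> T. 1 / prod g L) = prod f (S \<inter> T)" .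
      have "prod f (S \<union> T) * prod f (S \<inter> T) = prod f S * prod f T"
        using fin by (rule prod.union_inter)
      moreover have "prod f (S \<union> T) > 0"
        using fpos S T by (intro prod_pos) auto
      ultimately have 2: "1 / prod f (S \<union> T) = prod f (S \<inter> T) / (prod f S * prod f T)"
        using prodf[OF S] prodf[OF T] by (simp add: field_simps)
      have "w S * w T * (\<Prod>p\<in>S \<union> T. g p / (1 + g p)) = w S * w T * (1 / prod f (S \<union> T))"
        by (simp add: f_inv prod_dividef)
      also have "\<dots> = (w S / prod f S) * (w T / prod f T) * prod f (S \<inter> T)"
        unfolding 2 by simp
      also have "\<dots> = (\<Sum>L | L \<in> D \<and> L \<subseteq> S \<and> L \<subseteq> T. (w S / prod f S) * (w T / prod f T) / prod g L)"
        unfolding 1[symmetric] by (simp add: sum_distrib_left)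
      finally show ?thesis .
    qed
    have "(\<Sum>S\<in>D. \<Sum>T\<in>D. w S * w T * (\<Prod>p\<in>S \<union> T. g p / (1 + g p)))
        = (\<Sum>S\<in>D. \<Sum>T\<in>D. \<Sum>L\<in>D. if L \<subseteq> S \<and> L \<subseteq> T then (w S / prod f S) * (w T / prod f T) / prod g L else 0)"
      by (intro sum.cong refl) (simp only: step sum.inter_filter[OF finD])
    also have "\<dots> = (\<Sum>S\<in>D. \<Sum>L\<in>D. \<Sum>T\<in>D. if L \<subseteq> S \<and> L \<subseteq> T then (w S / prod f S) * (w T / prod f T) / prod g L else 0)"
      by (intro sum.cong refl sum.swap)
    also have "\<dots> = (\<Sum>L\<in>D. \<Sum>S\<in>D. \<Sum>T\<in>D. if L \<subseteq> S \<and> L \<subseteq> T then (w S / prod f S) * (w T / prod f T) / prod g L else 0)"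
      by (rule sum.swap)
    also have "\<dots> = (\<Sum>L\<in>D. prod g L / G\<^sup>2)"
    proof (intro sum.cong refl)
      fix L assume L: "L \<in> D"
      have "(\<Sum>S\<in>D. \<Sum>T\<in>D. if L \<subseteq> S \<and> L \<subseteq> T then (w S / prod f S) * (w T / prod f T) / prod g L else 0)
          = (\<Sum>S\<in>D. \<Sum>T\<in>D. (if L \<subseteq> S then w S / prod f S else 0) * (if L \<subseteq> T then w T / prod f T else 0)) / prod g L"
        unfolding sum_divide_distrib by (intro sum.cong refl) auto
      also have "\<dots> = (\<Sum>S\<in>D. if L \<subseteq> S then w S / prod f S else 0) ^ 2 / prod g L"
        by (simp add: power2_eq_square sum_product)
      also have "(\<Sum>S\<in>D. if L \<subseteq> S then w S / prod f S else 0) = (-1) ^ card L * prod g L / G"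
        using inner[OF L] finD by (simp add: sum.inter_filter)
      also have "((-1) ^ card L * prod g L / G)\<^sup>2 / prod g L = prod g L / G\<^sup>2"
        using prod_pos'[OF L] by (simp add: power_mult_distrib power_divide power2_eq_square flip: power_mult)
      finally show "(\<Sum>S\<in>D. \<Sum>T\<in>D. if L \<subseteq> S \<and> L \<subseteq> T then (w S / prod f S) * (w T / prod f T) / prod g L else 0)
        = prod g L / G\<^sup>2" .
    qed
    also have "\<dots> = 1 / G" using Gpos by (simp add: G_def power2_eq_square flip: sum_divide_distrib)
    finally show ?thesis .
  qed
  ultimately show ?thesis using that[of w] G_def by simp
qed

section \<open>Counting integers under periodic conditions\<close>

lemma card_less_periodic:
  fixes P :: "nat \<Rightarrow> bool"
  assumes per: "\<And>n. P (n mod q) = P n"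
  shows "card {n. n < j * q + s \<and> P n} = j * card {r. r < q \<and> P r} + card {r. r < s \<and> P r}"
proof (induction j)
  case (Suc j)
  have P_add: "P (n + q) = P n" for n
    using per[of "n + q"] per[of n] by simp
  have "{n. n < Suc j * q + s \<and> P n} = {r. r < q \<and> P r} \<union> (\<lambda>n. n + q) ` {n. n < j * q + s \<and> P n}"
  proof (intro equalityI subsetI)
    fix n assume n: "n \<in> {n. n < Suc j * q + s \<and> P n}"
    show "n \<in> {r. r < q \<and> P r} \<union> (\<lambda>n. n + q) ` {n. n < j * q + s \<and> P n}"
    proof (cases "n < q")
      case False
      then have "n = (n - q) + q" by simp
      moreover have "P (n - q)" using n P_add[of "n - q"] False by simp
      ultimately show ?thesis using n False by (intro UnI2 image_eqI[of _ _ "n - q"]) auto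
    qed (use n in auto)
  qed (auto simp: P_add)
  then have "card {n. n < Suc j * q + s \<and> P n}
      = card {r. r < q \<and> P r} + card ((\<lambda>n. n + q) ` {n. n < j * q + s \<and> P n})"
    by (simp only:) (subst card_Un_disjoint, auto)
  also have "card ((\<lambda>n. n + q) ` {n. n < j * q + s \<and> P n}) = card {n. n < j * q + s \<and> P n}"
    by (intro card_image) (auto intro: inj_onI)
  finally show ?case using Suc by simp
qed simp

lemma card_less_periodic_approx:
  fixes P :: "nat \<Rightarrow> bool"
  assumes per: "\<And>n. P (n mod q) = P n" and q: "q > 0"
  shows "\<bar>real (card {n. n < N \<and> P n}) - real N * real (card {r. r < q \<and> P r}) / real q\<bar> \<le> real q"
proof -
  define k where "k = card {r. r < q \<and> P r}"
  define s where "s = N mod q"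
  define c where "c = card {r. r < s \<and> P r}"
  have s: "s < q" using q by (simp add: s_def)
  have N: "N = (N div q) * q + s" by (simp add: s_def)
  have card: "card {n. n < N \<and> P n} = (N div q) * k + c"
    using card_less_periodic[of P q "N div q" s, OF per] N by (simp add: k_def c_def)
  have "card {r. r < q \<and> P r} \<le> card {..<q}" by (intro card_mono) auto
  then have kq: "k \<le> q" by (simp add: k_def)
  have "c \<le> k" unfolding c_def k_def using s by (intro card_mono) auto
  have "real N * real k / real q = real (N div q) * real k + real s * real k / real q"
    using q by (subst N) (simp add: field_simps del: div_mult_mod_eq mod_div_mult_eq)
  then have "real (card {n. n < N \<and> P n}) - real N * real k / real q = real c - real s * real k / real q"
    by (simp add: card)
  moreover have "real s * real k / real q \<le> real k"
    using s q by (auto simp: divide_le_eq mult.commute intro: mult_left_mono)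
  moreover have "real s * real k / real q \<ge> 0" by simp
  ultimately show ?thesis using \<open>c \<le> k\<close> kq unfolding k_def by linarith
qed

text \<open>By the Chinese remainder theorem, reduction modulo \<open>a\<close> and \<open>b\<close>
  is a bijection onto pairs of residues, and each condition sees only one component.\<close>

lemma card_less_coprime_periodic:
  fixes A B :: "nat \<Rightarrow> bool"
  assumes A: "\<And>n. A (n mod a) = A n" and B: "\<And>n. B (n mod b) = B n"
    and cop: "coprime a b" and pos: "a > 0" "b > 0"
  shows "card {n. n < a * b \<and> A n \<and> B n} = card {n. n < a \<and> A n} * card {n. n < b \<and> B n}"
proof -
  have "bij_betw (\<lambda>n. (n mod a, n mod b)) {n. n < a * b \<and> A n \<and> B n} ({n. n < a \<and> A n} \<times> {n. n < b \<and> B n})"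
  proof (rule bij_betwI')
    fix x y assume "x \<in> {n. n < a * b \<and> A n \<and> B n}" "y \<in> {n. n < a * b \<and> A n \<and> B n}"
    then have xy: "x < a * b" "y < a * b" by auto
    show "((x mod a, x mod b) = (y mod a, y mod b)) = (x = y)"
    proof
      assume "(x mod a, x mod b) = (y mod a, y mod b)"
      then have "[x = y] (mod a * b)" using cop by (intro coprime_cong_mult_nat) (auto simp: cong_def)
      then show "x = y" using xy by (simp add: cong_def)
    qed simp
  next
    fix x assume "x \<in> {n. n < a * b \<and> A n \<and> B n}"
    then show "(x mod a, x mod b) \<in> {n. n < a \<and> A n} \<times> {n. n < b \<and> B n}"
      using A B pos by auto
  next
    fix y assume y: "y \<in> {n. n < a \<and> A n} \<times> {n. n < b \<and> B n}"
    obtain u v where uv: "y = (u, v)" by force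
    obtain x where x: "[x = u] (mod a)" "[x = v] (mod b)"
      using binary_chinese_remainder_nat[OF cop] by blast
    define z where "z = x mod (a * b)"
    have z: "z < a * b" using pos by (simp add: z_def)
    have "z mod a = u" "z mod b = v"
      using x y uv by (auto simp: z_def cong_def mod_mod_cancel)
    moreover have "A z" "B z" using A[of z] B[of z] calculation y uv by auto
    ultimately show "\<exists>x\<in>{n. n < a * b \<and> A n \<and> B n}. y = (x mod a, x mod b)"
      using z uv by (intro bexI[of _ z]) auto
  qed
  then show ?thesis by (simp add: bij_betw_same_card card_cartesian_product)
qed

lemma card_less_prod_primes_periodic:
  fixes P :: "nat \<Rightarrow> nat \<Rightarrow> bool"
  assumes per: "\<And>p n. P p (n mod p) = P p n" and "finite S" "\<And>p. p \<in> S \<Longrightarrow> prime p"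
  shows "card {n. n < \<Prod>S \<and> (\<forall>p\<in>S. P p n)} = (\<Prod>p\<in>S. card {r. r < p \<and> P p r})"
  using assms(2,3)
proof (induction S)
  case empty
  then show ?case by simp
next
  case (insert p S)
  have pos: "\<Prod>S > 0" using insert by (intro prod_pos) (auto simp: prime_gt_0_nat)
  have "coprime p (\<Prod>S)" using insert by (intro prod_coprime_right primes_coprime) auto
  moreover have "(\<forall>r\<in>S. P r (n mod \<Prod>S)) = (\<forall>r\<in>S. P r n)" for n
  proof (intro ball_cong refl)
    fix r assume "r \<in> S"
    then have "r dvd \<Prod>S" using insert by (simp add: dvd_prod_eqI)
    then show "P r (n mod \<Prod>S) = P r n"
      using per[of r n] per[of r "n mod \<Prod>S"] by (simp add: mod_mod_cancel)
  qed
  ultimately have "card {n. n < p * \<Prod>S \<and> P p n \<and> (\<forall>r\<in>S. P r n)}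
      = card {n. n < p \<and> P p n} * card {n. n < \<Prod>S \<and> (\<forall>r\<in>S. P r n)}"
    using per pos insert by (intro card_less_coprime_periodic) (auto simp: prime_gt_0_nat)
  then show ?case using insert by simp
qed

text \<open>\<open>P p n\<close> says that \<open>n\<close> lies in one of the
  \<open>\<rho> p\<close> residue classes modulo \<open>p\<close> to be removed. The main term is
  \<open>N\<close> times the minimised quadratic form. The error comes from counting over incomplete
  periods and is bounded crudely, by the full period for each pair of sets.\<close>

theorem selberg_sieve:
  fixes P :: "nat \<Rightarrow> nat \<Rightarrow> bool" and D :: "nat set set"
  defines "\<rho> \<equiv> \<lambda>p. card {r. r < p \<and> P p r}"
  assumes per: "\<And>p n. P p (n mod p) = P p n"
    and finD: "finite D" and finS: "\<And>S. S \<in> D \<Longrightarrow> finite S"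
    and primes: "\<And>S p. S \<in> D \<Longrightarrow> p \<in> S \<Longrightarrow> prime p"
    and down: "\<And>S T. S \<in> D \<Longrightarrow> T \<subseteq> S \<Longrightarrow> T \<in> D" and ne: "{} \<in> D"
    and rho: "\<And>S p. S \<in> D \<Longrightarrow> p \<in> S \<Longrightarrow> 0 < \<rho> p \<and> \<rho> p < p"
  shows "real (card {n. n < N \<and> (\<forall>p\<in>\<Union>D. \<not> P p n)})
    \<le> real N / (\<Sum>S\<in>D. \<Prod>p\<in>S. real (\<rho> p) / (real p - real (\<rho> p))) + real (\<Sum>S\<in>D. (\<Prod>S)\<^sup>2) ^ 2"
proof -
  define g where "g = (\<lambda>p. real (\<rho> p) / (real p - real (\<rho> p)))"
  have rho': "0 < real (\<rho> p)" "real (\<rho> p) + 1 \<le> real p" if "S \<in> D" "p \<in> S" for S p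
    using rho[OF that] by auto
  have gpos: "g p > 0" if "S \<in> D" "p \<in> S" for S p
    using rho'[OF that] by (auto simp: g_def)
  have g1: "1 + g p = real p / (real p - real (\<rho> p))" "g p / (1 + g p) = real (\<rho> p) / real p"
    if "S \<in> D" "p \<in> S" for S p
    using rho'[OF that] by (auto simp: g_def field_simps)
  \<comment> \<open>Since \<open>\<rho> p\<close> is an integer below \<open>p\<close>, the
    denominator \<open>p - \<rho> p\<close> is at least 1. This gives the crude bound
    \<open>\<Prod>S\<close> for the weights.\<close>
  have g1_le: "1 + g p \<le> real p" if "S \<in> D" "p \<in> S" for S p
  proof -
    have "real p * 1 \<le> real p * (real p - real (\<rho> p))"
      using rho'[OF that] by (intro mult_left_mono) auto
    then show ?thesis using rho'[OF that] by (simp add: g1[OF that] divide_le_eq)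
  qed
  obtain w where w0: "w {} = (1::real)"
    and w_le: "\<And>S. S \<in> D \<Longrightarrow> \<bar>w S\<bar> \<le> (\<Prod>p\<in>S. 1 + g p)"
    and w_sum: "(\<Sum>S\<in>D. \<Sum>T\<in>D. w S * w T * (\<Prod>p\<in>S \<union> T. g p / (1 + g p))) = 1 / (\<Sum>S\<in>D. prod g S)"
    using selberg_weights[of D g] finD finS down ne gpos by blast
  have w_le': "\<bar>w S\<bar> \<le> real (\<Prod>S)" if "S \<in> D" for S
  proof -
    have "(\<Prod>p\<in>S. 1 + g p) \<le> (\<Prod>p\<in>S. real p)"
      using g1_le[OF that] gpos[OF that] by (intro prod_mono) (auto simp: add_nonneg_nonneg less_imp_le)
    then show ?thesis using w_le[OF that] by simp
  qed
  define cnt where "cnt = (\<lambda>U. card {n. n < N \<and> (\<forall>p\<in>U. P p n)})"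
  define dens where "dens = (\<lambda>U. \<Prod>p\<in>U. g p / (1 + g p))"
  have cnt: "\<bar>real (cnt (S \<union> T)) - real N * dens (S \<union> T)\<bar> \<le> real (\<Prod>S) * real (\<Prod>T)"
    if S: "S \<in> D" and T: "T \<in> D" for S T
  proof -
    define U where "U = S \<union> T"
    have U: "finite U" "\<And>p. p \<in> U \<Longrightarrow> prime p"
      using S T finS primes by (auto simp: U_def)
    have pos: "\<Prod>X > 0" if "X \<subseteq> U" for X
      using U that by (intro prod_pos) (auto simp: prime_gt_0_nat)
    have "(\<forall>r\<in>U. P r (n mod \<Prod>U)) = (\<forall>r\<in>U. P r n)" for n
    proof (intro ball_cong refl)
      fix r assume "r \<in> U"
      then have "r dvd \<Prod>U" using U by (simp add: dvd_prod_eqI)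
      then show "P r (n mod \<Prod>U) = P r n"
        using per[of r n] per[of r "n mod \<Prod>U"] by (simp add: mod_mod_cancel)
    qed
    then have "\<bar>real (cnt U) - real N * real (card {n. n < \<Prod>U \<and> (\<forall>p\<in>U. P p n)}) / real (\<Prod>U)\<bar> \<le> real (\<Prod>U)"
      unfolding cnt_def using pos[of U] by (intro card_less_periodic_approx) auto
    moreover have "real (card {n. n < \<Prod>U \<and> (\<forall>p\<in>U. P p n)}) / real (\<Prod>U) = (\<Prod>p\<in>U. real (\<rho> p) / real p)"
      unfolding \<rho>_def using U per
      by (subst card_less_prod_primes_periodic[of P]) (auto simp: prod_dividef)
    moreover have "(\<Prod>p\<in>U. real (\<rho> p) / real p) = dens U"
      unfolding dens_def using g1(2) S T by (intro prod.cong) (auto simp: U_def)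
    ultimately have "\<bar>real (cnt U) - real N * dens U\<bar> \<le> real (\<Prod>U)"
      by (simp only: times_divide_eq_right[symmetric])
    also have "\<Prod>U \<le> \<Prod>S * \<Prod>T"
    proof -
      have "\<Prod>U * 1 \<le> \<Prod>U * \<Prod>(S \<inter> T)"
        using pos[of "S \<inter> T"] by (intro mult_left_mono) (auto simp: U_def Suc_le_eq)
      then show ?thesis unfolding U_def using prod.union_inter[of S T "\<lambda>x. x"] finS S T by simp
    qed
    finally show ?thesis by (simp add: U_def)
  qed
  have "real (card {n. n < N \<and> (\<forall>p\<in>\<Union>D. \<not> P p n)}) = (\<Sum>n<N. of_bool (\<forall>p\<in>\<Union>D. \<not> P p n))"
    by (simp add: sum.If_cases of_bool_def lessThan_def Collect_conj_eq)
  \<comment> \<open>Selberg's majorant: for an unsifted \<open>n\<close> only \<open>S = {}\<close>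
    contributes, and \<open>w {} = 1\<close>; for all other \<open>n\<close> a square is nonnegative
    whatever the weights are.\<close>
  also have "\<dots> \<le> (\<Sum>n<N. (\<Sum>S\<in>D. if \<forall>p\<in>S. P p n then w S else 0) ^ 2)"
  proof (intro sum_mono)
    fix n
    show "of_bool (\<forall>p\<in>\<Union>D. \<not> P p n) \<le> (\<Sum>S\<in>D. if \<forall>p\<in>S. P p n then w S else 0) ^ 2"
    proof (cases "\<forall>p\<in>\<Union>D. \<not> P p n")
      case True
      have "(\<Sum>S\<in>D. if \<forall>p\<in>S. P p n then w S else 0) = (\<Sum>S\<in>D. if S = {} then w S else 0)"
        using True by (intro sum.cong refl) auto
      also have "\<dots> = 1" using ne finD w0 by simp
      finally show ?thesis by simp
    next
      case False
      then show ?thesis by (simp only: of_bool_eq zero_le_power2)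
    qed
  qed
  also have "\<dots> = (\<Sum>n<N. \<Sum>S\<in>D. \<Sum>T\<in>D. w S * w T * of_bool (\<forall>p\<in>S \<union> T. P p n))"
    unfolding power2_eq_square sum_product by (intro sum.cong refl) auto
  also have "\<dots> = (\<Sum>S\<in>D. \<Sum>n<N. \<Sum>T\<in>D. w S * w T * of_bool (\<forall>p\<in>S \<union> T. P p n))"
    by (rule sum.swap)
  also have "\<dots> = (\<Sum>S\<in>D. \<Sum>T\<in>D. \<Sum>n<N. w S * w T * of_bool (\<forall>p\<in>S \<union> T. P p n))"
    by (intro sum.cong refl sum.swap)
  also have "\<dots> = (\<Sum>S\<in>D. \<Sum>T\<in>D. w S * w T * real (cnt (S \<union> T)))"
    unfolding sum_distrib_left[symmetric] cnt_def
    by (intro sum.cong refl) (simp add: sum.If_cases of_bool_def lessThan_def Collect_conj_eq)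
  also have "\<dots> \<le> (\<Sum>S\<in>D. \<Sum>T\<in>D. real N * (w S * w T * dens (S \<union> T)) + real ((\<Prod>S)\<^sup>2) * real ((\<Prod>T)\<^sup>2))"
  proof (intro sum_mono)
    fix S T assume S: "S \<in> D" and T: "T \<in> D"
    have "w S * w T * (real (cnt (S \<union> T)) - real N * dens (S \<union> T))
        \<le> \<bar>w S\<bar> * \<bar>w T\<bar> * \<bar>real (cnt (S \<union> T)) - real N * dens (S \<union> T)\<bar>"
      by (metis abs_ge_self abs_mult)
    also have "\<dots> \<le> (real (\<Prod>S) * real (\<Prod>T)) * (real (\<Prod>S) * real (\<Prod>T))"
      using w_le' cnt S T by (intro mult_mono) (auto intro!: mult_nonneg_nonneg prod_nonneg)
    finally show "w S * w T * real (cnt (S \<union> T))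
      \<le> real N * (w S * w T * dens (S \<union> T)) + real ((\<Prod>S)\<^sup>2) * real ((\<Prod>T)\<^sup>2)"
      by (simp add: power2_eq_square algebra_simps)
  qed
  also have "\<dots> = real N * (\<Sum>S\<in>D. \<Sum>T\<in>D. w S * w T * dens (S \<union> T)) + real (\<Sum>S\<in>D. (\<Prod>S)\<^sup>2) ^ 2"
    by (simp only: sum.distrib sum_distrib_left[symmetric] of_nat_sum sum_product
        power2_eq_square[of "\<Sum>S\<in>D. real ((\<Prod>S)\<^sup>2)"])
  also have "(\<Sum>S\<in>D. \<Sum>T\<in>D. w S * w T * dens (S \<union> T)) = 1 / (\<Sum>S\<in>D. prod g S)"
    unfolding dens_def by (rule w_sum)
  finally show ?thesis by (simp add: g_def)
qed

text \<open>The root 0 is always present. The factor \<open>m * r + 1\<close> adds the root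
  \<open>-1 / m\<close>, which is nonzero, exactly when \<open>m\<close> is invertible modulo
  \<open>p\<close>.\<close>

lemma card_roots_mult_linear:
  assumes p: "prime p"
  shows "card {r::nat. r < p \<and> p dvd r * (m * r + 1)} = (if p dvd m then 1 else 2)"
proof (cases "p dvd m")
  case True
  have "{r. r < p \<and> p dvd r * (m * r + 1)} = {0}"
  proof (intro equalityI subsetI)
    fix r assume r: "r \<in> {r. r < p \<and> p dvd r * (m * r + 1)}"
    then have "p dvd r \<or> p dvd m * r + 1" using prime_dvd_mult_iff[OF p] by blast
    moreover have "\<not> p dvd m * r + 1"
      using True p dvd_add_right_iff[of p "m * r" 1] not_prime_unit[of p] by auto
    ultimately show "r \<in> {0}" using r by (auto dest: dvd_imp_le)
  qed (use p in \<open>auto simp: prime_gt_0_nat\<close>)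
  then show ?thesis using True by simp
next
  case False
  have p0: "p > 0" "p > 1" using prime_gt_0_nat[OF p] prime_gt_1_nat[OF p] by auto
  have cop: "coprime m p" using prime_imp_coprime[OF p False] by (simp add: coprime_commute)
  obtain y where y: "[m * y = 1] (mod p)"
    using cong_solve_coprime_nat[OF cop] by auto
  \<comment> \<open>This is \<open>-1 / m\<close> modulo \<open>p\<close>: \<open>p - 1\<close>
    stands for \<open>-1\<close> and \<open>y\<close> is the inverse of \<open>m\<close>.\<close>
  define s where "s = ((p - 1) * y) mod p"
  have s: "s < p" using p0 by (simp add: s_def)
  have "[m * s + 1 = m * ((p - 1) * y) + 1] (mod p)"
    by (intro cong_add cong_mult cong_refl) (simp add: s_def cong_def)
  also have "m * ((p - 1) * y) + 1 = (p - 1) * (m * y) + 1" by (simp add: ac_simps)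
  also have "[(p - 1) * (m * y) + 1 = (p - 1) * 1 + 1] (mod p)"
    using y by (intro cong_add cong_mult cong_refl)
  also have "(p - 1) * 1 + 1 = p" using p0 by simp
  finally have ps: "p dvd m * s + 1" by (simp add: cong_def mod_eq_0_iff_dvd)
  have uniq: "r = s" if "r < p" "p dvd m * r + 1" for r
  proof -
    have "[m * r + 1 = m * s + 1] (mod p)"
      using that(2) ps by (meson cong_0_iff cong_sym cong_trans)
    then have "[m * r = m * s] (mod p)" by (simp only: cong_add_rcancel_nat)
    then have "[r = s] (mod p)" using cop by (simp add: cong_mult_lcancel_nat)
    then show ?thesis using that s by (simp add: cong_def)
  qed
  have "s \<noteq> 0" using ps p0 by (intro notI) simp
  have "{r. r < p \<and> p dvd r * (m * r + 1)} = {0, s}"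
  proof (intro equalityI subsetI)
    fix r assume r: "r \<in> {r. r < p \<and> p dvd r * (m * r + 1)}"
    then have "p dvd r \<or> p dvd m * r + 1" using prime_dvd_mult_iff[OF p] by blast
    then show "r \<in> {0, s}" using r uniq by (auto dest: dvd_imp_le)
  qed (use p0 s dvd_mult[OF ps, of s] in auto)
  then show ?thesis using \<open>s \<noteq> 0\<close> False by simp
qed

section \<open>Sifting n (m n + 1)\<close>

text \<open>The squarefree integers up to \<open>Z\<close>, encoded by their sets of prime factors.
  Bounding the product instead of the primes keeps the sieve error polynomial in
  \<open>Z\<close>.\<close>

definition prime_sets :: "nat \<Rightarrow> nat set set" where
  "prime_sets Z = {S. finite S \<and> (\<forall>p\<in>S. prime p) \<and> \<Prod>S \<le> Z}"

lemma prod_primes_pos: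
  fixes S :: "nat set"
  assumes "\<And>p. p \<in> S \<Longrightarrow> prime p"
  shows "\<Prod>S > 0"
  by (intro prod_pos prime_gt_0_nat assms)

lemma prime_factors_prod_primes:
  fixes S :: "nat set"
  assumes "finite S" "\<And>p. p \<in> S \<Longrightarrow> prime p"
  shows "prime_factors (\<Prod>S) = S"
proof -
  have "prime_factorization (\<Prod>S) = (\<Sum>p\<in>S. {#p#})"
    using assms(1) prime_gt_0_nat[OF assms(2)]
    by (subst prime_factorization_prod) (simp_all add: prime_factorization_prime assms(2))
  then show ?thesis using assms(1) by (simp add: set_mset_sum)
qed

lemma prod_prime_factors_dvd:
  fixes n :: nat
  assumes "n > 0"
  shows "\<Prod>(prime_factors n) dvd n"
proof -
  have "\<Prod>(prime_factors n) dvd (\<Prod>p\<in>prime_factors n. p ^ multiplicity p n)"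
    using assms by (intro prod_dvd_prod dvd_power)
      (auto simp: prime_factors_multiplicity)
  then show ?thesis using prime_factorization_nat[OF assms] by simp
qed

lemma prime_sets_subset:
  assumes "S \<in> prime_sets Z" "T \<subseteq> S"
  shows "T \<in> prime_sets Z"
proof -
  have S: "finite S" "\<And>p. p \<in> S \<Longrightarrow> prime p" "\<Prod>S \<le> Z"
    using assms by (auto simp: prime_sets_def)
  have "\<Prod>T dvd \<Prod>S" using S assms(2) by (intro prod_dvd_prod_subset) auto
  then have "\<Prod>T \<le> \<Prod>S" using prod_primes_pos[OF S(2)] by (intro dvd_imp_le) auto
  moreover have "finite T" using finite_subset[OF assms(2) S(1)] .
  moreover have "\<forall>p\<in>T. prime p" using S(2) assms(2) by blast
  ultimately show ?thesis using S(3) by (simp add: prime_sets_def)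
qed

text \<open>Unique factorisation makes the product injective into \<open>{1..Z}\<close>, so there
  are at most \<open>Z\<close> sets, each contributing at most \<open>Z\<^sup>2\<close>.\<close>

lemma finite_prime_sets: "finite (prime_sets Z)"
  and sum_prod_square_prime_sets: "(\<Sum>S\<in>prime_sets Z. (\<Prod>S)\<^sup>2) \<le> Z ^ 3"
proof -
  have inj: "inj_on Prod (prime_sets Z)"
  proof (rule inj_on_inverseI[where g = prime_factors])
    fix S assume "S \<in> prime_sets Z"
    then show "prime_factors (\<Prod>S) = S"
      by (intro prime_factors_prod_primes) (auto simp: prime_sets_def)
  qed
  have img: "Prod ` prime_sets Z \<subseteq> {1..Z}"
  proof (rule image_subsetI)
    fix S assume S: "S \<in> prime_sets Z"
    then have "\<Prod>S > 0" by (intro prod_primes_pos) (auto simp: prime_sets_def)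
    then show "\<Prod>S \<in> {1..Z}"
      using S unfolding prime_sets_def atLeastAtMost_iff One_nat_def Suc_le_eq by blast
  qed
  show fin: "finite (prime_sets Z)"
    using finite_imageD[OF finite_subset[OF img] inj] by simp
  have card: "card (prime_sets Z) \<le> Z" using card_inj_on_le[OF inj img] by simp
  have "(\<Sum>S\<in>prime_sets Z. (\<Prod>S)\<^sup>2) \<le> (\<Sum>S\<in>prime_sets Z. Z\<^sup>2)"
    by (intro sum_mono power_mono) (auto simp: prime_sets_def)
  also have "\<dots> \<le> Z * Z\<^sup>2" using card by simp
  finally have "(\<Sum>S\<in>prime_sets Z. (\<Prod>S)\<^sup>2) \<le> Z * Z\<^sup>2" .
  then show "(\<Sum>S\<in>prime_sets Z. (\<Prod>S)\<^sup>2) \<le> Z ^ 3" by (simp add: power2_eq_square power3_eq_cube)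
qed

section \<open>Lower bound for the sieve denominator\<close>

lemma sum_inverse_powers_le:
  assumes "p \<ge> 2"
  shows "(\<Sum>k=1..K. (1 / real p) ^ k) \<le> 1 / (real p - 1)"
proof -
  have "(\<Sum>k=1..K. (1 / real p) ^ k) = (1 - (1 / real p) ^ K) / (real p - 1)"
  proof (induction K)
    case (Suc K)
    have "(1 - a) / (real p - 1) + a * (1 / real p) = (1 - a * (1 / real p)) / (real p - 1)" for a
      using assms by (simp add: field_simps)
    from this[of "(1 / real p) ^ K"] show ?case using Suc by (simp add: mult.commute)
  qed simp
  also have "\<dots> \<le> 1 / (real p - 1)"
    using assms by (intro divide_right_mono) auto
  finally show ?thesis .
qed

text \<open>Such an \<open>n\<close> is determined by its exponents, all between 1 and
  \<open>Y\<close>. So the sum is at most a product of truncated geometric series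
  \<open>1 / p + 1 / p\<^sup>2 + ...\<close>, each bounded by \<open>1 / (p - 1)\<close>.\<close>

lemma sum_inverse_fixed_prime_factors_le:
  assumes S: "finite S" "\<And>p. p \<in> S \<Longrightarrow> prime p"
  shows "(\<Sum>n | n \<in> {1..Y} \<and> prime_factors n = S. 1 / real n) \<le> (\<Prod>p\<in>S. 1 / (real p - 1))"
proof -
  define F where "F = {n \<in> {1..Y}. prime_factors n = S}"
  have nF: "n = (\<Prod>p\<in>S. p ^ multiplicity p n)" if "n \<in> F" for n
    using prime_factorization_nat[of n] that by (auto simp: F_def)
  have "(\<Sum>n\<in>F. 1 / real n) \<le> (\<Sum>e\<in>PiE S (\<lambda>_. {1..Y}). \<Prod>p\<in>S. (1 / real p) ^ e p)"
  proof (rule sum_le_included[where i = "\<lambda>e. \<Prod>p\<in>S. p ^ e p"])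
    show "\<forall>n\<in>F. \<exists>e\<in>PiE S (\<lambda>_. {1..Y}). (\<Prod>p\<in>S. p ^ e p) = n \<and> 1 / real n \<le> (\<Prod>p\<in>S. (1 / real p) ^ e p)"
    proof
      fix n assume n: "n \<in> F"
      define e where "e = restrict (\<lambda>p. multiplicity p n) S"
      have prod: "(\<Prod>p\<in>S. p ^ e p) = n"
        using nF[OF n] by (simp add: e_def cong: prod.cong)
      have "multiplicity p n \<in> {1..Y}" if "p \<in> S" for p
      proof -
        have p: "prime p" using S that by auto
        have "multiplicity p n < 2 ^ multiplicity p n" by simp
        also have "\<dots> \<le> p ^ multiplicity p n" using prime_ge_2_nat[OF p] by (intro power_mono) auto
        also have "\<dots> \<le> n" using n by (intro dvd_imp_le multiplicity_dvd) (auto simp: F_def)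
        finally show ?thesis using n that by (auto simp: F_def prime_factors_multiplicity)
      qed
      then have "e \<in> PiE S (\<lambda>_. {1..Y})" by (auto simp: e_def)
      moreover have "1 / real n = (\<Prod>p\<in>S. (1 / real p) ^ e p)"
        by (simp add: prod[symmetric] power_one_over prod_dividef)
      ultimately show "\<exists>e\<in>PiE S (\<lambda>_. {1..Y}). (\<Prod>p\<in>S. p ^ e p) = n \<and> 1 / real n \<le> (\<Prod>p\<in>S. (1 / real p) ^ e p)"
        using prod by auto
    qed
  qed (use S in \<open>auto simp: F_def intro!: finite_PiE prod_nonneg\<close>)
  also have "\<dots> = (\<Prod>p\<in>S. \<Sum>k\<in>{1..Y}. (1 / real p) ^ k)"
    using S by (subst prod_sum_PiE) auto
  also have "\<dots> \<le> (\<Prod>p\<in>S. 1 / (real p - 1))"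
    using S by (intro prod_mono conjI sum_inverse_powers_le sum_nonneg) (auto simp: prime_ge_2_nat)
  finally show ?thesis by (simp add: F_def)
qed

text \<open>The integers up to \<open>Y\<close> are grouped by their radical, which is again at most
  \<open>Y\<close>. This yields a logarithmic lower bound without any knowledge of the distribution
  of primes.\<close>

lemma harm_le_sum_prime_sets:
  "harm Y \<le> (\<Sum>S\<in>prime_sets Y. \<Prod>p\<in>S. 1 / (real p - 1))"
proof -
  have "harm Y = (\<Sum>n\<in>{1..Y}. 1 / real n)" by (simp add: harm_def inverse_eq_divide)
  also have "\<dots> = (\<Sum>S\<in>prime_factors ` {1..Y}. \<Sum>n | n \<in> {1..Y} \<and> prime_factors n = S. 1 / real n)"
    by (rule sum.image_gen) simp
  also have "\<dots> \<le> (\<Sum>S\<in>prime_factors ` {1..Y}. \<Prod>p\<in>S. 1 / (real p - 1))"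
    by (intro sum_mono sum_inverse_fixed_prime_factors_le) auto
  also have "\<dots> \<le> (\<Sum>S\<in>prime_sets Y. \<Prod>p\<in>S. 1 / (real p - 1))"
  proof (intro sum_mono2 finite_prime_sets)
    show "prime_factors ` {1..Y} \<subseteq> prime_sets Y"
    proof (rule image_subsetI)
      fix n assume n: "n \<in> {1..Y}"
      then have "\<Prod>(prime_factors n) \<le> n" by (intro dvd_imp_le prod_prime_factors_dvd) auto
      then show "prime_factors n \<in> prime_sets Y" using n by (auto simp: prime_sets_def)
    qed
    fix S assume "S \<in> prime_sets Y - prime_factors ` {1..Y}"
    then have "real p - 1 \<ge> 0" if "p \<in> S" for p
      using that prime_ge_1_nat[of p] by (auto simp: prime_sets_def)
    then show "(\<Prod>p\<in>S. 1 / (real p - 1)) \<ge> 0" by (intro prod_nonneg) auto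
  qed
  finally show ?thesis .
qed

text \<open>The sum factors over primes: \<open>p \<in> M\<close> must lie in \<open>A\<close>
  alone, giving \<open>u p\<close>; any other \<open>p\<close> lies in \<open>A\<close> only, in
  \<open>B\<close> only or in both, giving \<open>2 * u p + (u p)\<^sup>2\<close>. The proof
  parametrises the pairs by \<open>B\<close> and \<open>C = A \<inter> B\<close>.\<close>

lemma sum_pairs_union_eq:
  fixes u :: "'a \<Rightarrow> real"
  assumes "finite S"
  shows "(\<Sum>(A, B) | A \<union> B = S \<and> B \<inter> M = {}. prod u A * prod u B)
    = (\<Prod>p\<in>S. if p \<in> M then u p else 2 * u p + (u p)\<^sup>2)"
proof -
  have fin: "finite X" if "X \<subseteq> S" for X using assms that finite_subset by blast
  have "(\<Sum>(A, B) | A \<union> B = S \<and> B \<inter> M = {}. prod u A * prod u B)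
      = (\<Sum>(B, C)\<in>Sigma (Pow (S - M)) Pow. prod u ((S - B) \<union> C) * prod u B)"
    by (rule sum.reindex_bij_witness[where i = "\<lambda>(B, C). ((S - B) \<union> C, B)" and j = "\<lambda>(A, B). (B, A \<inter> B)"])
      (auto intro!: arg_cong2[where f = "(*)"] arg_cong[where f = "prod u"])
  also have "\<dots> = (\<Sum>B\<in>Pow (S - M). \<Sum>C\<in>Pow B. prod u ((S - B) \<union> C) * prod u B)"
    using assms fin by (subst sum.Sigma) auto
  also have "\<dots> = (\<Sum>B\<in>Pow (S - M). prod u (S \<inter> M) * ((\<Prod>p\<in>B. u p * (1 + u p)) * prod u (S - M - B)))"
  proof (intro sum.cong refl)
    fix B assume "B \<in> Pow (S - M)"
    then have B: "B \<subseteq> S - M" by simp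
    have "(\<Sum>C\<in>Pow B. prod u ((S - B) \<union> C) * prod u B) = (\<Sum>C\<in>Pow B. prod u (S - B) * prod u B * prod u C)"
    proof (intro sum.cong refl)
      fix C assume "C \<in> Pow B"
      then show "prod u ((S - B) \<union> C) * prod u B = prod u (S - B) * prod u B * prod u C"
        using B fin[of C] fin[of "S - B"] by (subst prod.union_disjoint) auto
    qed
    also have "\<dots> = prod u (S - B) * prod u B * (\<Prod>p\<in>B. 1 + u p)"
      using fin[of B] B by (subst prod_one_plus_eq_sum_Pow) (auto simp: sum_distrib_left)
    also have "prod u (S - B) = prod u (S \<inter> M) * prod u (S - M - B)"
      using B fin by (subst prod.union_disjoint[symmetric]) (auto intro!: arg_cong[where f = "prod u"])
    finally show "(\<Sum>C\<in>Pow B. prod u ((S - B) \<union> C) * prod u B)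
      = prod u (S \<inter> M) * ((\<Prod>p\<in>B. u p * (1 + u p)) * prod u (S - M - B))"
      by (simp add: prod.distrib)
  qed
  also have "\<dots> = prod u (S \<inter> M) * (\<Prod>p\<in>S - M. u p * (1 + u p) + u p)"
    using assms by (subst prod_add) (auto simp: sum_distrib_left)
  also have "\<dots> = (\<Prod>p\<in>S \<inter> M. if p \<in> M then u p else 2 * u p + (u p)\<^sup>2)
      * (\<Prod>p\<in>S - M. if p \<in> M then u p else 2 * u p + (u p)\<^sup>2)"
    by (intro arg_cong2[where f = "(*)"] prod.cong) (auto simp: power2_eq_square algebra_simps)
  also have "\<dots> = (\<Prod>p\<in>S. if p \<in> M then u p else 2 * u p + (u p)\<^sup>2)"
    using assms by (subst prod.union_disjoint[symmetric]) (auto intro!: prod.cong)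
  finally show ?thesis .
qed

text \<open>
  The summand on the right is the sum of \<open>prod u A * prod u B\<close> over all \<open>A \<union> B = S\<close> such that \<open>B\<close>
  avoids \<open>M\<close>. Removing the condition on \<open>B\<close> costs the factor \<open>\<Prod>p\<in>M. 1 + u p\<close>.
\<close>

lemma sum_prime_sets_square_le:
  fixes u :: "nat \<Rightarrow> real"
  assumes u: "\<And>p. prime p \<Longrightarrow> u p \<ge> 0" and M: "finite M" "\<And>p. p \<in> M \<Longrightarrow> prime p"
  shows "(\<Sum>S\<in>prime_sets Y. prod u S)\<^sup>2 \<le> (\<Prod>p\<in>M. 1 + u p) *
    (\<Sum>S\<in>prime_sets (Y\<^sup>2). \<Prod>p\<in>S. if p \<in> M then u p else 2 * u p + (u p)\<^sup>2)"
proof -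
  define U where "U = (\<Sum>S\<in>prime_sets Y. prod u S)"
  define D where "D = {S \<in> prime_sets Y. S \<inter> M = {}}"
  define v where "v = (\<lambda>p. if p \<in> M then u p else 2 * u p + (u p)\<^sup>2)"
  have finD: "finite D" by (simp add: D_def finite_prime_sets)
  have nonneg: "prod u S \<ge> 0" if "S \<in> prime_sets Z" for S Z
    using that u by (intro prod_nonneg) (auto simp: prime_sets_def)
  have nonneg_v: "prod v S \<ge> 0" if "S \<in> prime_sets Z" for S Z
    using that u by (intro prod_nonneg) (auto simp: prime_sets_def v_def)
  have U0: "U \<ge> 0" unfolding U_def by (intro sum_nonneg nonneg)
  \<comment> \<open>Each \<open>A\<close> splits into \<open>A - M\<close> and
    \<open>A \<inter> M\<close>. Letting the second part range over all subsets of \<open>M\<close>,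
    whatever their product, makes the sum factor.\<close>
  have "U \<le> (\<Sum>(B, C)\<in>D \<times> Pow M. prod u B * prod u C)"
    unfolding U_def
  proof (rule sum_le_included[where i = "\<lambda>(B, C). B \<union> C"])
    show "\<forall>A\<in>prime_sets Y. \<exists>y\<in>D \<times> Pow M. (case y of (B, C) \<Rightarrow> B \<union> C) = A \<and>
      prod u A \<le> (case y of (B, C) \<Rightarrow> prod u B * prod u C)"
    proof
      fix A assume A: "A \<in> prime_sets Y"
      have "A - M \<in> D" using prime_sets_subset[OF A, of "A - M"] by (auto simp: D_def)
      moreover have "finite A" using A by (simp add: prime_sets_def)
      then have "prod u A = prod u (A - M) * prod u (A \<inter> M)"
        by (subst prod.union_disjoint[symmetric]) (auto intro!: arg_cong[where f = "prod u"])
      ultimately show "\<exists>y\<in>D \<times> Pow M. (case y of (B, C) \<Rightarrow> B \<union> C) = A \<and>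
          prod u A \<le> (case y of (B, C) \<Rightarrow> prod u B * prod u C)"
        by (intro bexI[of _ "(A - M, A \<inter> M)"]) auto
    qed
    show "\<forall>y\<in>D \<times> Pow M. 0 \<le> (case y of (B, C) \<Rightarrow> prod u B * prod u C)"
    proof safe
      fix B C assume "B \<in> D" "C \<subseteq> M"
      then show "prod u B * prod u C \<ge> 0"
        using M u by (intro mult_nonneg_nonneg nonneg prod_nonneg) (auto simp: D_def)
    qed
  qed (use finD M finite_prime_sets in auto)
  also have "\<dots> = (\<Sum>B\<in>D. prod u B) * (\<Prod>p\<in>M. 1 + u p)"
    using M by (simp add: prod_one_plus_eq_sum_Pow sum_product sum.cartesian_product)
  finally have 1: "U \<le> (\<Sum>B\<in>D. prod u B) * (\<Prod>p\<in>M. 1 + u p)" .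
  have fin_pairs: "finite {(A, B). A \<union> B = S \<and> B \<inter> M = {}}" if "S \<in> prime_sets Z" for S Z
  proof -
    have "{(A, B). A \<union> B = S \<and> B \<inter> M = {}} \<subseteq> Pow S \<times> Pow S" by auto
    then show ?thesis by (rule finite_subset) (use that in \<open>simp add: prime_sets_def\<close>)
  qed
  have "U * (\<Sum>B\<in>D. prod u B) = (\<Sum>(A, B)\<in>prime_sets Y \<times> D. prod u A * prod u B)"
    by (simp add: U_def sum_product sum.cartesian_product)
  \<comment> \<open>Pairs are grouped by their union, whose product is a least common multiple of
    two integers up to \<open>Y\<close>; this is why the range grows to
    \<open>Y\<^sup>2\<close>.\<close>
  also have "\<dots> \<le> (\<Sum>(S, A, B)\<in>Sigma (prime_sets (Y\<^sup>2)) (\<lambda>S. {(A, B). A \<union> B = S \<and> B \<inter> M = {}}). prod u A * prod u B)"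
  proof (rule sum_le_included[where i = snd])
    show "finite (Sigma (prime_sets (Y\<^sup>2)) (\<lambda>S. {(A, B). A \<union> B = S \<and> B \<inter> M = {}}))"
      by (intro finite_SigmaI finite_prime_sets fin_pairs)
    show "\<forall>x\<in>prime_sets Y \<times> D. \<exists>y\<in>Sigma (prime_sets (Y\<^sup>2)) (\<lambda>S. {(A, B). A \<union> B = S \<and> B \<inter> M = {}}).
       snd y = x \<and> (case x of (A, B) \<Rightarrow> prod u A * prod u B) \<le> (case y of (S, A, B) \<Rightarrow> prod u A * prod u B)"
    proof safe
      fix A B assume A: "A \<in> prime_sets Y" and B: "B \<in> D"
      have fin: "finite A" "finite B" using A B by (auto simp: prime_sets_def D_def)
      have AB: "\<Prod>A \<le> Y" "\<Prod>B \<le> Y" using A B by (auto simp: prime_sets_def D_def)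
      have "\<Prod>(A \<union> B) * \<Prod>(A \<inter> B) = \<Prod>A * \<Prod>B" using fin by (rule prod.union_inter)
      moreover have "\<Prod>(A \<inter> B) > 0" using A by (intro prod_primes_pos) (auto simp: prime_sets_def)
      ultimately have "\<Prod>(A \<union> B) \<le> \<Prod>A * \<Prod>B"
        using mult_le_mono2[of 1 "\<Prod>(A \<inter> B)" "\<Prod>(A \<union> B)"] by simp
      also have "\<dots> \<le> Y * Y" using AB by (intro mult_mono) auto
      finally have "A \<union> B \<in> prime_sets (Y\<^sup>2)"
        using A B by (auto simp: prime_sets_def D_def power2_eq_square)
      then show "\<exists>y\<in>Sigma (prime_sets (Y\<^sup>2)) (\<lambda>S. {(A, B). A \<union> B = S \<and> B \<inter> M = {}}).
         snd y = (A, B) \<and> prod u A * prod u B \<le> (case y of (S, A, B) \<Rightarrow> prod u A * prod u B)"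
        using B by (intro bexI[of _ "(A \<union> B, A, B)"]) (auto simp: D_def)
    qed
    show "\<forall>y\<in>Sigma (prime_sets (Y\<^sup>2)) (\<lambda>S. {(A, B). A \<union> B = S \<and> B \<inter> M = {}}).
        0 \<le> (case y of (S, A, B) \<Rightarrow> prod u A * prod u B)"
      using u by (auto simp: prime_sets_def intro!: mult_nonneg_nonneg prod_nonneg)
  qed (use finD finite_prime_sets in auto)
  also have "\<dots> = (\<Sum>S\<in>prime_sets (Y\<^sup>2). \<Sum>(A, B) | A \<union> B = S \<and> B \<inter> M = {}. prod u A * prod u B)"
  proof (subst sum.Sigma)
    show "\<forall>S\<in>prime_sets (Y\<^sup>2). finite {(A, B). A \<union> B = S \<and> B \<inter> M = {}}"
      by (intro ballI fin_pairs)
  qed (auto simp: finite_prime_sets)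
  also have "\<dots> = (\<Sum>S\<in>prime_sets (Y\<^sup>2). prod v S)"
    by (intro sum.cong refl) (simp add: sum_pairs_union_eq prime_sets_def v_def)
  finally have 2: "U * (\<Sum>B\<in>D. prod u B) \<le> (\<Sum>S\<in>prime_sets (Y\<^sup>2). prod v S)" .
  have W: "(\<Prod>p\<in>M. 1 + u p) \<ge> 0" using M u by (intro prod_nonneg) (auto simp: add_nonneg_nonneg)
  have "U\<^sup>2 \<le> U * ((\<Sum>B\<in>D. prod u B) * (\<Prod>p\<in>M. 1 + u p))"
    using 1 U0 by (simp add: power2_eq_square mult_left_mono)
  also have "\<dots> = (\<Prod>p\<in>M. 1 + u p) * (U * (\<Sum>B\<in>D. prod u B))" by simp
  also have "\<dots> \<le> (\<Prod>p\<in>M. 1 + u p) * (\<Sum>S\<in>prime_sets (Y\<^sup>2). prod v S)"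
    using 2 W by (rule mult_left_mono)
  finally show ?thesis by (simp add: U_def v_def)
qed

text \<open>The Euler product of \<open>m / \<phi>(m)\<close>. It plays the part of the singular
  series for the prime pairs \<open>q\<close>, \<open>m * q + 1\<close>, up to a constant.\<close>

definition sing_weight :: "nat \<Rightarrow> real" where
  "sing_weight m = (\<Prod>p\<in>prime_factors m. real p / (real p - 1))"

text \<open>The sieve is applied with squarefree moduli up to \<open>Y\<^sup>2\<close>, so the error
  is at most \<open>((Y\<^sup>2) ^ 3) ^ 2\<close>. The local factors are \<open>1 / (p - 1)\<close>
  for \<open>p dvd m\<close> and \<open>2 / (p - 2)\<close> otherwise; they dominate those produced
  by squaring the sum of \<open>1 / \<phi>\<close>.\<close>

theorem card_sifted_mult_linear_le:
  assumes m: "even m" "m > 0" and Y: "Y \<ge> 2"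
  shows "real (card {n. n < N \<and> (\<forall>p. prime p \<and> p \<le> Y\<^sup>2 \<longrightarrow> \<not> p dvd n * (m * n + 1))})
    \<le> real N * sing_weight m / (ln (real Y))\<^sup>2 + real Y ^ 12"
proof -
  define D where "D = prime_sets (Y\<^sup>2)"
  define P where "P = (\<lambda>p n. p dvd n * (m * n + 1))"
  define \<rho> where "\<rho> = (\<lambda>p. card {r. r < p \<and> P p r})"
  define u where "u = (\<lambda>p::nat. 1 / (real p - 1))"
  define v where "v = (\<lambda>p. if p \<in> prime_factors m then u p else 2 * u p + (u p)\<^sup>2)"
  have per: "P p (n mod p) = P p n" for p n
  proof -
    have "[(n mod p) * (m * (n mod p) + 1) = n * (m * n + 1)] (mod p)"
      by (intro cong_mult cong_add cong_refl) (auto simp: cong_def)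
    then show ?thesis unfolding P_def by (rule cong_dvd_iff)
  qed
  have \<rho>: "\<rho> p = (if p dvd m then 1 else 2)" if "prime p" for p
    unfolding \<rho>_def P_def using card_roots_mult_linear[OF that] .
  \<comment> \<open>Evenness of \<open>m\<close> enters here: for odd \<open>m\<close> both classes
    modulo 2 would be removed and the local factor \<open>2 / (p - 2)\<close> would
    degenerate.\<close>
  have p3: "p \<ge> 3" if "prime p" "\<not> p dvd m" for p
    using that m(1) prime_ge_2_nat[of p] by (cases "p = 2") auto
  have rho: "0 < \<rho> p \<and> \<rho> p < p" if "prime p" for p
    using prime_ge_2_nat[OF that] p3[OF that] by (auto simp: \<rho>[OF that])
  have UD: "p \<in> \<Union>D \<longleftrightarrow> prime p \<and> p \<le> Y\<^sup>2" for p
  proof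
    assume "p \<in> \<Union>D"
    then obtain S where S: "S \<in> prime_sets (Y\<^sup>2)" "p \<in> S" by (auto simp: D_def)
    then show "prime p \<and> p \<le> Y\<^sup>2"
      using prime_sets_subset[OF S(1), of "{p}"] by (auto simp: prime_sets_def)
  next
    assume "prime p \<and> p \<le> Y\<^sup>2"
    then have "{p} \<in> D" by (simp add: D_def prime_sets_def)
    then show "p \<in> \<Union>D" by blast
  qed
  have "real (card {n. n < N \<and> (\<forall>p\<in>\<Union>D. \<not> P p n)})
      \<le> real N / (\<Sum>S\<in>D. \<Prod>p\<in>S. real (\<rho> p) / (real p - real (\<rho> p))) + real (\<Sum>S\<in>D. (\<Prod>S)\<^sup>2) ^ 2"
    unfolding \<rho>_def
  proof (rule selberg_sieve)
    show "{} \<in> D" using Y by (simp add: D_def prime_sets_def)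
    show "\<And>S T. S \<in> D \<Longrightarrow> T \<subseteq> S \<Longrightarrow> T \<in> D" unfolding D_def by (rule prime_sets_subset)
  qed (use per finite_prime_sets rho in \<open>auto simp: D_def prime_sets_def \<rho>_def\<close>)
  also have "{n. n < N \<and> (\<forall>p\<in>\<Union>D. \<not> P p n)} = {n. n < N \<and> (\<forall>p. prime p \<and> p \<le> Y\<^sup>2 \<longrightarrow> \<not> p dvd n * (m * n + 1))}"
    by (simp only: Ball_def UD P_def)
  also have "real (\<Sum>S\<in>D. (\<Prod>S)\<^sup>2) ^ 2 \<le> real ((Y\<^sup>2) ^ 3) ^ 2"
    unfolding D_def by (intro power_mono of_nat_mono sum_prod_square_prime_sets of_nat_0_le_iff)
  also have "real ((Y\<^sup>2) ^ 3) ^ 2 = real Y ^ 12" by (simp flip: power_mult)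
  also have "real N / (\<Sum>S\<in>D. \<Prod>p\<in>S. real (\<rho> p) / (real p - real (\<rho> p))) \<le> real N * sing_weight m / (ln (real Y))\<^sup>2"
  proof -
    define G where "G = (\<Sum>S\<in>D. \<Prod>p\<in>S. real (\<rho> p) / (real p - real (\<rho> p)))"
    have lnY: "ln (real Y) > 0" using Y by simp
    have W: "sing_weight m = (\<Prod>p\<in>prime_factors m. 1 + u p)"
      unfolding sing_weight_def
    proof (intro prod.cong refl)
      fix p assume "p \<in> prime_factors m"
      then have "p \<ge> 2" by (intro prime_ge_2_nat in_prime_factors_imp_prime)
      then show "real p / (real p - 1) = 1 + u p" by (simp add: u_def field_simps)
    qed
    have u0: "u p \<ge> 0" if "prime p" for p using prime_ge_1_nat[OF that] by (simp add: u_def)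
    have "(ln (real Y))\<^sup>2 \<le> (\<Sum>S\<in>prime_sets Y. prod u S)\<^sup>2"
    proof (intro power_mono)
      have "ln (real Y) \<le> ln (real Y + 1)" using Y by simp
      also have "\<dots> \<le> harm Y" by (rule ln_le_harm)
      also have "\<dots> \<le> (\<Sum>S\<in>prime_sets Y. prod u S)" unfolding u_def by (rule harm_le_sum_prime_sets)
      finally show "ln (real Y) \<le> (\<Sum>S\<in>prime_sets Y. prod u S)" .
    qed (use lnY in auto)
    also have "\<dots> \<le> sing_weight m * (\<Sum>S\<in>D. prod v S)"
      unfolding W D_def v_def using u0 by (intro sum_prime_sets_square_le) auto
    also have "\<dots> \<le> sing_weight m * G"
    proof (intro mult_left_mono)
      show "sing_weight m \<ge> 0" unfolding W using u0
        by (intro prod_nonneg) (auto simp: add_nonneg_nonneg in_prime_factors_imp_prime)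
      show "(\<Sum>S\<in>D. prod v S) \<le> G" unfolding G_def
      proof (intro sum_mono prod_mono conjI)
        fix S p assume "S \<in> D" "p \<in> S"
        then have p: "prime p" by (auto simp: D_def prime_sets_def)
        show "v p \<ge> 0" using u0[OF p] by (simp add: v_def)
        show "v p \<le> real (\<rho> p) / (real p - real (\<rho> p))"
        proof (cases "p dvd m")
          case True
          then show ?thesis using p m by (simp add: v_def \<rho> u_def in_prime_factors_iff)
        next
          case False
          \<comment> \<open>This is \<open>(1 + u p)\<^sup>2 \<le> p / (p - 2)\<close>, i.e. \<open>p (p - 2) \<le> (p - 1)\<^sup>2\<close>.\<close>
          define s where "s = real p - 1"
          have s: "s \<ge> 2" "real p = s + 1" using p3[OF p False] by (auto simp: s_def)
          have "2 * (1 / s) + (1 / s)\<^sup>2 = (2 * s + 1) / s\<^sup>2"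
            using s(1) by (simp add: field_simps power2_eq_square)
          also have "\<dots> \<le> 2 / (s - 1)"
          proof (rule mult_imp_div_pos_le)
            have "2 * s + 1 \<le> 2 * s\<^sup>2 / (s - 1)"
              using s(1) by (intro mult_imp_le_div_pos) (simp_all add: power2_eq_square algebra_simps)
            then show "2 * s + 1 \<le> 2 / (s - 1) * s\<^sup>2" by simp
          qed (use s in simp)
          finally show ?thesis using False p s(2) by (simp add: v_def \<rho> u_def in_prime_factors_iff)
        qed
      qed
    qed
    finally have main: "(ln (real Y))\<^sup>2 \<le> sing_weight m * G" .
    have W0: "sing_weight m > 0" unfolding W using u0
      by (intro prod_pos) (auto simp: add_pos_nonneg in_prime_factors_imp_prime)
    have "sing_weight m * G > 0" using lnY by (intro less_le_trans[OF _ main] zero_less_power)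
    then have "G > 0" using W0 by (simp add: zero_less_mult_iff)
    have "real N / G * (ln (real Y))\<^sup>2 \<le> real N / G * (sing_weight m * G)"
      using main \<open>G > 0\<close> by (intro mult_left_mono) auto
    also have "\<dots> = real N * sing_weight m" using \<open>G > 0\<close> by simp
    finally show ?thesis using lnY by (simp add: G_def[symmetric] le_divide_eq)
  qed
  finally show ?thesis by simp
qed

section \<open>The average of m / \<open>\<phi>\<close>(m)\<close>

text \<open>All factors are at least 1, so the product may be extended to all integers from 2 to
  \<open>K\<close>, where it telescopes.\<close>

lemma prod_square_ratio_le:
  assumes "finite S" "\<And>p. p \<in> S \<Longrightarrow> p \<ge> (2::nat)"
  shows "(\<Prod>p\<in>S. (real p)\<^sup>2 / ((real p)\<^sup>2 - 1)) \<le> 2"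
proof -
  have telescope: "(\<Prod>p\<in>{2..k}. (real p)\<^sup>2 / ((real p)\<^sup>2 - 1)) = 2 * real k / (real k + 1)" if "k \<ge> 1" for k
    using that
  proof (induction k rule: dec_induct)
    case base
    then show ?case by simp
  next
    case (step k)
    have "(real (Suc k))\<^sup>2 - 1 = real k * (real k + 2)" by (simp add: power2_eq_square algebra_simps)
    moreover have "{2..Suc k} = insert (Suc k) {2..k}" using step by auto
    ultimately have "(\<Prod>p\<in>{2..Suc k}. (real p)\<^sup>2 / ((real p)\<^sup>2 - 1))
        = (real k + 1)\<^sup>2 / (real k * (real k + 2)) * (2 * real k / (real k + 1))"
      using step by (simp add: add.commute)
    also have "\<dots> = 2 * (real k + 1) / (real k + 2)"
    proof -
      have "(a + 1)\<^sup>2 / (a * (a + 2)) * (2 * a / (a + 1)) = 2 * (a + 1) / (a + 2)" if "a > 0" for a :: real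
      proof -
        have nz: "a * (a + 2) * (a + 1) \<noteq> 0" "a + 2 \<noteq> 0" using that by auto
        show ?thesis
          unfolding times_divide_times_eq frac_eq_eq[OF nz] by (simp add: power2_eq_square algebra_simps)
      qed
      then show ?thesis using step by simp
    qed
    finally show ?case by (simp add: add.commute)
  qed
  define K where "K = Max (insert 1 S)"
  have "S \<subseteq> {2..K}" using assms by (auto simp: K_def)
  moreover have ge1: "(real p)\<^sup>2 / ((real p)\<^sup>2 - 1) \<ge> 1" if "p \<ge> 2" for p
  proof -
    have "(real p)\<^sup>2 > 1" using that by (intro one_less_power) auto
    then show ?thesis by simp
  qed
  ultimately have "(\<Prod>p\<in>S. (real p)\<^sup>2 / ((real p)\<^sup>2 - 1)) \<le> (\<Prod>p\<in>{2..K}. (real p)\<^sup>2 / ((real p)\<^sup>2 - 1))"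
    using assms by (intro prod_mono2) (auto intro: order_trans[OF zero_le_one ge1])
  also have "\<dots> = 2 * real K / (real K + 1)"
    using telescope assms(1) by (simp add: K_def)
  also have "2 * real K / (real K + 1) \<le> 2" by (simp add: divide_le_eq)
  finally show ?thesis using assms by (simp add: K_def)
qed

text \<open>Since \<open>p / (p - 1) = p\<^sup>2 / (p\<^sup>2 - 1) * (1 + 1 / p)\<close>, a bounded
  product splits off, and the rest expands into the sum of \<open>1 / d\<close> over squarefree
  divisors. A divisor sum is easy to average.\<close>

lemma sing_weight_le:
  assumes "m > 0"
  shows "sing_weight m \<le> 2 * (\<Sum>d | d dvd m. 1 / real d)"
proof -
  define M where "M = prime_factors m"
  have M: "finite M" "\<And>p. p \<in> M \<Longrightarrow> prime p" by (auto simp: M_def)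
  have ge2: "p \<ge> 2" if "p \<in> M" for p using M(2)[OF that] by (rule prime_ge_2_nat)
  have "sing_weight m = (\<Prod>p\<in>M. (real p)\<^sup>2 / ((real p)\<^sup>2 - 1) * (1 + 1 / real p))"
    unfolding sing_weight_def M_def[symmetric]
  proof (intro prod.cong refl)
    fix p assume "p \<in> M"
    then have p: "real p \<ge> 2" using ge2 by force
    have "(real p)\<^sup>2 - 1 = (real p - 1) * (real p + 1)" by (simp add: power2_eq_square algebra_simps)
    then show "real p / (real p - 1) = (real p)\<^sup>2 / ((real p)\<^sup>2 - 1) * (1 + 1 / real p)"
      using p by (simp add: divide_simps) (simp add: power2_eq_square algebra_simps)
  qed
  also have "\<dots> = (\<Prod>p\<in>M. (real p)\<^sup>2 / ((real p)\<^sup>2 - 1)) * (\<Prod>p\<in>M. 1 + 1 / real p)"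
    by (rule prod.distrib)
  also have "\<dots> \<le> 2 * (\<Prod>p\<in>M. 1 + 1 / real p)"
    using M(1) ge2 by (intro mult_right_mono prod_square_ratio_le prod_nonneg) auto
  also have "(\<Prod>p\<in>M. 1 + 1 / real p) = (\<Sum>X\<in>Pow M. \<Prod>p\<in>X. 1 / real p)"
    using M(1) by (rule prod_one_plus_eq_sum_Pow)
  also have "\<dots> \<le> (\<Sum>d | d dvd m. 1 / real d)"
  proof (rule sum_le_included[where i = prime_factors])
    show "\<forall>X\<in>Pow M. \<exists>d\<in>{d. d dvd m}. prime_factors d = X \<and> (\<Prod>p\<in>X. 1 / real p) \<le> 1 / real d"
    proof
      fix X assume X: "X \<in> Pow M"
      then have "\<Prod>X dvd \<Prod>M" using M(1) by (intro prod_dvd_prod_subset) auto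
      then have "\<Prod>X dvd m" using prod_prime_factors_dvd[OF assms] by (auto simp: M_def intro: dvd_trans)
      moreover have "prime_factors (\<Prod>X) = X"
        using X M finite_subset[of X M] by (intro prime_factors_prod_primes) auto
      ultimately show "\<exists>d\<in>{d. d dvd m}. prime_factors d = X \<and> (\<Prod>p\<in>X. 1 / real p) \<le> 1 / real d"
        by (intro bexI[of _ "\<Prod>X"]) (auto simp: prod_dividef)
    qed
  qed (use M assms in auto)
  finally show ?thesis by simp
qed

lemma sum_inverse_squares_le: "(\<Sum>d=1..n. 1 / (real d)\<^sup>2) \<le> 2"
proof -
  have "(\<Sum>d=1..n. 1 / (real d)\<^sup>2) \<le> 2 - 1 / real n" if "n \<ge> 1"
    using that
  proof (induction n rule: dec_induct)
    case base
    then show ?case by simp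
  next
    case (step n)
    have "1 / (real (Suc n))\<^sup>2 \<le> 1 / (real n * real (Suc n))"
      using step by (intro divide_left_mono) (auto simp: power2_eq_square)
    also have "\<dots> = 1 / real n - 1 / real (Suc n)" using step by (simp add: field_simps)
    finally show ?case using step by simp
  qed
  moreover have "1 / real n \<ge> 0" by simp
  ultimately show ?thesis by (cases "n \<ge> 1") (auto intro: order_trans)
qed

lemma harm_le_one_plus_ln:
  assumes "n \<ge> 1"
  shows "harm n \<le> 1 + ln (real n)"
  using euler_mascheroni_sequence_decreasing[of 1 n] assms by (simp add: harm_expand)

text \<open>Writing \<open>m = d * k\<close> turns the divisor sum into the convergent sum of
  \<open>1 / d\<^sup>2\<close> times a harmonic sum. Hence, on average, the weight costs only a
  constant.\<close>

theorem sum_sing_weight_le: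
  assumes "M \<ge> 1"
  shows "(\<Sum>m=1..M. sing_weight m / real m) \<le> 4 * (1 + ln (real M))"
proof -
  have "(\<Sum>m=1..M. sing_weight m / real m) \<le> (\<Sum>m=1..M. \<Sum>d | d dvd m. 2 * (1 / (real d * real m)))"
  proof (intro sum_mono)
    fix m assume "m \<in> {1..M}"
    then have "sing_weight m / real m \<le> (2 * (\<Sum>d | d dvd m. 1 / real d)) / real m"
      by (intro divide_right_mono sing_weight_le) auto
    then show "sing_weight m / real m \<le> (\<Sum>d | d dvd m. 2 * (1 / (real d * real m)))"
      by (simp add: sum_distrib_left sum_divide_distrib)
  qed
  also have "\<dots> = (\<Sum>(m, d)\<in>Sigma {1..M} (\<lambda>m. {d. d dvd m}). 2 * (1 / (real d * real m)))"
    by (subst sum.Sigma) auto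
  also have "\<dots> \<le> (\<Sum>(d, k)\<in>{1..M} \<times> {1..M}. 2 * ((1 / (real d)\<^sup>2) * (1 / real k)))"
  proof (rule sum_le_included[where i = "\<lambda>(d, k). (d * k, d)"])
    show "\<forall>x\<in>Sigma {1..M} (\<lambda>m. {d. d dvd m}). \<exists>y\<in>{1..M} \<times> {1..M}. (case y of (d, k) \<Rightarrow> (d * k, d)) = x \<and>
      (case x of (m, d) \<Rightarrow> 2 * (1 / (real d * real m))) \<le> (case y of (d, k) \<Rightarrow> 2 * ((1 / (real d)\<^sup>2) * (1 / real k)))"
    proof safe
      fix m d assume m: "m \<in> {1..M}" and "d dvd m"
      then obtain k where k: "m = d * k" by (auto simp: dvd_def)
      then have "d \<ge> 1" "k \<ge> 1" "d dvd m" "k dvd m" using m by (auto simp: Suc_le_eq intro: gr0I)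
      moreover have "d \<le> M" "k \<le> M" using m calculation(3,4) by (auto dest!: dvd_imp_le)
      ultimately show "\<exists>y\<in>{1..M} \<times> {1..M}. (case y of (d, k) \<Rightarrow> (d * k, d)) = (m, d) \<and>
          2 * (1 / (real d * real m)) \<le> (case y of (d, k) \<Rightarrow> 2 * ((1 / (real d)\<^sup>2) * (1 / real k)))"
        using k by (intro bexI[of _ "(d, k)"]) (auto simp: power2_eq_square)
    qed
  qed auto
  also have "\<dots> = 2 * ((\<Sum>d=1..M. 1 / (real d)\<^sup>2) * harm M)"
    by (simp only: harm_def inverse_eq_divide of_nat_id sum_product[symmetric]
        sum.cartesian_product[symmetric] sum_distrib_left[symmetric] sum_distrib_right[symmetric])
  also have "\<dots> \<le> 2 * (2 * (1 + ln (real M)))"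
    using assms by (intro mult_left_mono mult_mono sum_inverse_squares_le harm_le_one_plus_ln)
      (auto intro: harm_nonneg)
  finally show ?thesis by simp
qed

section \<open>Chebyshev's lower bound\<close>

text \<open>
  The entries \<open>a n k = n * ((n - 1) choose k)\<close> of Leibniz' harmonic triangle satisfy
  \<open>1 / a n (k + 1) = 1 / a (n - 1) k - 1 / a n k\<close>; multiplied by \<open>d\<close>, both terms on the right are
  integers by induction.
\<close>
lemma times_binomial_dvd:
  fixes d :: nat
  assumes "d > 0" "\<And>i. 1 \<le> i \<Longrightarrow> i \<le> n \<Longrightarrow> i dvd d" "k < n"
  shows "n * ((n - 1) choose k) dvd d"
  using assms(2,3)
proof (induction k arbitrary: n)
  case 0
  then show ?case by simp
next
  case (Suc k)
  define m where "m = n - 1"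
  have n: "n = Suc m" "k < m" using Suc.prems by (auto simp: m_def)
  obtain a where a: "d = n * (m choose k) * a"
    using Suc.IH[of n] Suc.prems n by (auto simp: dvd_def)
  obtain b where b: "d = m * ((m - 1) choose k) * b"
    using Suc.IH[of m] Suc.prems n by (auto simp: dvd_def)
  have e1: "Suc k * (m choose Suc k) = m * ((m - 1) choose k)"
    using binomial_absorption[of k m] by simp
  have e2: "Suc k * (m choose Suc k) = (m - k) * (m choose k)"
    by (simp only: e1 binomial_absorb_comp)
  have d1: "int d = int (m choose Suc k) * int (Suc k) * int b"
    unfolding b e1[symmetric] by (simp add: algebra_simps)
  have d2: "int (m - k) * int d = int n * int (m choose Suc k) * int (Suc k) * int a"
  proof -
    have "(m - k) * d = n * ((m - k) * (m choose k)) * a" by (simp add: a)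
    then have "(m - k) * d = n * (Suc k * (m choose Suc k)) * a" unfolding e2 .
    then show ?thesis by (metis (no_types, lifting) mult.assoc mult.commute of_nat_mult)
  qed
  \<comment> \<open>The triangle identity with denominators cleared, from
    \<open>Suc k = n - (m - k)\<close>. Working in the integers makes \<open>b - a\<close> a true
    difference.\<close>
  have "int (Suc k) * int d = int n * int d - int (m - k) * int d"
    using n by (simp add: of_nat_diff algebra_simps)
  also have "int n * int d = int n * int (m choose Suc k) * int (Suc k) * int b"
    by (subst d1) (simp add: mult.assoc)
  finally have "int (Suc k) * int d = int (Suc k) * (int (n * (m choose Suc k)) * (int b - int a))"
    unfolding d2 by (simp add: algebra_simps)
  then have "int d = int (n * (m choose Suc k)) * (int b - int a)"
    by (simp del: of_nat_Suc)
  then have "int (n * (m choose Suc k)) dvd int d" by (rule dvdI)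
  then show ?case by (simp add: m_def of_nat_dvd_iff del: of_nat_mult)
qed

text \<open>The \<open>n\<close> entries of a row of the triangle sum to
  \<open>n * 2 ^ (n - 1)\<close>, and each divides the least common multiple, hence is at most that
  large.\<close>

lemma Lcm_atLeastAtMost_ge:
  assumes "n > 0"
  shows "2 ^ (n - 1) \<le> (Lcm {1..n} :: nat)"
proof -
  define d where "d = (Lcm {1..n} :: nat)"
  have d0: "d > 0" unfolding d_def by (intro Nat.gr0I) (simp add: Lcm_0_iff)
  have "n * 2 ^ (n - 1) = (\<Sum>k\<le>n - 1. n * ((n - 1) choose k))"
    by (simp add: choose_row_sum flip: sum_distrib_left)
  also have "\<dots> \<le> (\<Sum>k\<le>n - 1. d)"
    using assms d0 by (intro sum_mono dvd_imp_le times_binomial_dvd) (auto simp: d_def intro: dvd_Lcm)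
  also have "\<dots> = n * d" using assms by simp
  finally show ?thesis using assms by (simp add: d_def)
qed

lemma prime_power_dvd_Lcm:
  fixes p :: nat
  assumes "finite A" "prime p" "p ^ k dvd Lcm A" "k > 0"
  shows "\<exists>a\<in>A. p ^ k dvd a"
  using assms
proof (induction A)
  case empty
  then show ?case by (auto simp: prime_gt_1_nat)
next
  case (insert a A)
  show ?case
  proof (cases "a = 0 \<or> Lcm A = 0")
    case True
    then show ?thesis
    proof
      assume "Lcm A = 0"
      then have "0 \<in> A" using insert by (simp add: Lcm_0_iff)
      then show ?thesis by (intro bexI[of _ 0]) auto
    qed auto
  next
    case False
    then have "k \<le> multiplicity p (lcm a (Lcm A))"
      using insert by (intro multiplicity_geI) (auto simp: lcm_eq_0_iff)
    then have "k \<le> multiplicity p a \<or> k \<le> multiplicity p (Lcm A)"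
      using False insert by (simp add: multiplicity_lcm le_max_iff_disj)
    then show ?thesis using insert multiplicity_dvd'[of k p] by auto
  qed
qed

text \<open>The full power of a prime in the least common multiple already divides some integer up
  to \<open>n\<close>, so every prime contributes at most a factor \<open>n\<close>.\<close>

lemma Lcm_atLeastAtMost_le:
  assumes "n > 0"
  shows "(Lcm {1..n} :: nat) \<le> n ^ card {p. prime p \<and> p \<le> n}"
proof -
  define d where "d = (Lcm {1..n} :: nat)"
  have d0: "d > 0" unfolding d_def by (intro Nat.gr0I) (simp add: Lcm_0_iff)
  have pm: "p ^ multiplicity p d \<le> n \<and> p \<le> n" if p: "p \<in> prime_factors d" for p
  proof -
    have pp: "prime p" and m0: "multiplicity p d > 0"
      using p by (auto simp: prime_factors_multiplicity)
    obtain a where a: "a \<in> {1..n}" "p ^ multiplicity p d dvd a"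
      using prime_power_dvd_Lcm[of "{1..n}" p "multiplicity p d"] pp m0 multiplicity_dvd[of p d]
      by (auto simp: d_def)
    then have le: "p ^ multiplicity p d \<le> n" by (auto dest!: dvd_imp_le)
    moreover have "p \<le> p ^ multiplicity p d"
      using m0 prime_gt_0_nat[OF pp] by (simp add: self_le_power)
    ultimately show ?thesis by simp
  qed
  have "d = (\<Prod>p\<in>prime_factors d. p ^ multiplicity p d)" using d0 by (rule prime_factorization_nat)
  also have "\<dots> \<le> (\<Prod>p\<in>prime_factors d. n)" using pm by (intro prod_mono) auto
  also have "\<dots> = n ^ card (prime_factors d)" by simp
  also have "\<dots> \<le> n ^ card {p. prime p \<and> p \<le> n}"
    using assms pm by (intro power_increasing card_mono) (auto simp: in_prime_factors_imp_prime)
  finally show ?thesis by (simp add: d_def)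
qed

theorem prime_count_ge:
  assumes "x \<ge> 4"
  shows "real (prime_count x) \<ge> x / (4 * ln x)"
proof -
  define n where "n = nat \<lfloor>x\<rfloor>"
  have n: "n > 0" "real n \<le> x" "x < real n + 1" using assms by (auto simp: n_def)
  have "real p \<le> x \<longleftrightarrow> p \<le> n" for p using n(2,3) by linarith
  then have pc: "prime_count x = card {p. prime p \<and> p \<le> n}" by (simp add: prime_count_def)
  have "(2::nat) ^ (n - 1) \<le> n ^ prime_count x"
    unfolding pc using Lcm_atLeastAtMost_ge[OF n(1)] Lcm_atLeastAtMost_le[OF n(1)] by linarith
  then have "real (2 ^ (n - 1)) \<le> real (n ^ prime_count x)" by (rule of_nat_mono)
  then have "ln (2 ^ (n - 1)) \<le> ln (real n ^ prime_count x)"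
    using n by (subst ln_le_cancel_iff) auto
  then have "real (n - 1) * ln 2 \<le> real (prime_count x) * ln (real n)"
    using n by (simp add: ln_realpow)
  also have "\<dots> \<le> real (prime_count x) * ln x"
    using n by (intro mult_left_mono) auto
  finally have 1: "real (n - 1) * ln 2 \<le> real (prime_count x) * ln x" .
  have ln2: "ln (2::real) \<ge> 1 / 2" using ln2_ge_two_thirds by simp
  \<comment> \<open>Here \<open>x \<ge> 4\<close> is used:
    \<open>n - 1 > x - 2 \<ge> x / 2\<close>.\<close>
  have "x / 4 \<le> real (n - 1) * (1 / 2)" using n assms by (simp add: of_nat_diff)
  also have "\<dots> \<le> real (n - 1) * ln 2" using ln2 by (intro mult_left_mono) auto
  finally have "x / 4 \<le> real (prime_count x) * ln x" using 1 by linarith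
  moreover have "ln x > 0" using assms by simp
  ultimately show ?thesis by (simp add: divide_le_eq)
qed

section \<open>Primes with a large prime factor of the predecessor\<close>

text \<open>If \<open>q > Y\<^sup>2\<close>, a prime up to \<open>Y\<^sup>2\<close> dividing
  \<open>q * (m * q + 1)\<close> would equal one of the two larger primes, so \<open>q\<close>
  survives the sieve. One \<open>Y ^ 12\<close> pays for the small \<open>q\<close>, the other for
  the sieve error. For odd \<open>m\<close> no large \<open>q\<close> exists, because
  \<open>m * q + 1\<close> would be even.\<close>

lemma card_prime_pairs_le:
  assumes m: "m \<ge> 1" "real m \<le> x" and Y: "Y \<ge> 2"
  shows "real (card {q. prime q \<and> prime (m * q + 1) \<and> real (m * q) \<le> x})
    \<le> 2 * real Y ^ 12 + 2 * x / (ln (real Y))\<^sup>2 * (sing_weight m / real m)"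
proof -
  define Q where "Q = {q. prime q \<and> prime (m * q + 1) \<and> real (m * q) \<le> x}"
  define N where "N = nat \<lfloor>x / real m\<rfloor> + 1"
  define A where "A = {n. n < N \<and> (\<forall>p. prime p \<and> p \<le> Y\<^sup>2 \<longrightarrow> \<not> p dvd n * (m * n + 1))}"
  have sw: "sing_weight m \<ge> 0" unfolding sing_weight_def
  proof (intro prod_nonneg)
    fix p assume "p \<in> prime_factors m"
    then have "p \<ge> 1" by (intro prime_ge_1_nat in_prime_factors_imp_prime)
    then show "0 \<le> real p / (real p - 1)" by simp
  qed
  have Y12: "real (card {..Y\<^sup>2}) \<le> real Y ^ 12"
  proof -
    have "Y\<^sup>2 + 1 \<le> Y\<^sup>2 * Y" using mult_le_mono2[OF Y, of "Y\<^sup>2"] Y by (simp add: Suc_le_eq)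
    also have "\<dots> = Y ^ 3" by (simp add: power2_eq_square power3_eq_cube)
    also have "\<dots> \<le> Y ^ 12" using Y by (intro power_increasing) auto
    finally have "card {..Y\<^sup>2} \<le> Y ^ 12" by simp
    then show ?thesis by (metis of_nat_mono of_nat_power)
  qed
  have large: "q \<in> A" if q: "q \<in> Q" "q > Y\<^sup>2" for q
  proof -
    have pr: "prime q" "prime (m * q + 1)" and le: "real m * real q \<le> x" using q by (auto simp: Q_def)
    have "real q \<le> x / real m" using le m by (simp add: le_divide_eq mult.commute)
    then have "q < N" by (simp add: N_def le_nat_floor less_Suc_eq_le)
    moreover have "\<not> p dvd q * (m * q + 1)" if p: "prime p" "p \<le> Y\<^sup>2" for p
    proof
      assume "p dvd q * (m * q + 1)"
      then have "p dvd q \<or> p dvd m * q + 1" using prime_dvd_mult_iff[OF p(1)] by blast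
      then have "p = q \<or> p = m * q + 1" using p pr primes_dvd_imp_eq by blast
      moreover have "q \<le> m * q" using m by simp
      ultimately show False using p q by linarith
    qed
    ultimately show ?thesis by (simp add: A_def)
  qed
  have even: "even m" if q: "q \<in> Q" "q > Y\<^sup>2" for q
  proof (rule ccontr)
    assume "odd m"
    have pr: "prime q" "prime (m * q + 1)" using q by (auto simp: Q_def)
    have "Y\<^sup>2 \<ge> 2\<^sup>2" using Y by (intro power_mono) auto
    then have "q > 2" using q by simp
    then have "odd q" using pr prime_odd_nat by blast
    then have "even (m * q + 1)" using \<open>odd m\<close> by simp
    moreover have "q \<le> m * q" using m by simp
    then have "m * q + 1 > 2" using \<open>q > 2\<close> by linarith
    ultimately show False using pr(2) prime_odd_nat by blast
  qed
  have finA: "finite A" by (simp add: A_def)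
  have rest: "2 * x / (ln (real Y))\<^sup>2 * (sing_weight m / real m) \<ge> 0"
    using sw m by (intro mult_nonneg_nonneg divide_nonneg_nonneg) auto
  show ?thesis
  proof (cases "even m")
    case False
    then have "Q \<subseteq> {..Y\<^sup>2}" using even by force
    then have "real (card Q) \<le> real (card {..Y\<^sup>2})" by (intro of_nat_mono card_mono) auto
    then show ?thesis using Y12 rest by (simp add: Q_def)
  next
    case True
    have "Q \<subseteq> {..Y\<^sup>2} \<union> A" using large by force
    then have "card Q \<le> card ({..Y\<^sup>2} \<union> A)" using finA by (intro card_mono) auto
    also have "\<dots> \<le> card {..Y\<^sup>2} + card A" by (rule card_Un_le)
    finally have "real (card Q) \<le> real (card {..Y\<^sup>2}) + real (card A)"
      unfolding of_nat_add[symmetric] by (rule of_nat_mono)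
    also have "real (card A) \<le> real N * sing_weight m / (ln (real Y))\<^sup>2 + real Y ^ 12"
      unfolding A_def using True m Y by (intro card_sifted_mult_linear_le) auto
    also have "real N * sing_weight m / (ln (real Y))\<^sup>2 \<le> (2 * x / real m) * sing_weight m / (ln (real Y))\<^sup>2"
    proof (intro divide_right_mono mult_right_mono sw)
      have "x / real m \<ge> 1" using m by (simp add: le_divide_eq)
      then show "real N \<le> 2 * x / real m" unfolding N_def by linarith
    qed simp
    finally show ?thesis using Y12 by (simp add: Q_def mult_ac)
  qed
qed

lemma shifted_prime_pairs:
  assumes c: "0 < c" "c < 1" and p: "prime p" "real p \<le> x"
    and large: "real (largest_prime_factor (p - 1)) \<ge> real p powr c"
  shows "\<exists>m q. m \<ge> 1 \<and> real m \<le> x powr (1 - c) \<and> prime q \<and> p = m * q + 1"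
proof -
  have p2: "p \<ge> 2" using p by (simp add: prime_ge_2_nat)
  \<comment> \<open>This discards \<open>p = 2\<close>, where the convention gives the value 1 at
    \<open>p - 1 = 1\<close>, less than \<open>2 powr c\<close>.\<close>
  have "p - 1 > 1"
  proof (rule ccontr)
    assume "\<not> p - 1 > 1"
    then have "real p powr c \<le> 1" using large by (simp add: largest_prime_factor_def)
    moreover have "real p powr c > 1" using p2 c by (intro gr_one_powr) auto
    ultimately show False by simp
  qed
  define q where "q = Max (prime_factors (p - 1))"
  have "prime_factors (p - 1) \<noteq> {}"
    using \<open>p - 1 > 1\<close> prime_factorization_empty_iff[of "p - 1"] by auto
  then have "q \<in> prime_factors (p - 1)" unfolding q_def by (intro Max_in) auto
  then have q: "prime q" "q dvd p - 1" by (auto simp: in_prime_factors_iff)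
  obtain m where m: "p - 1 = q * m" using q(2) by (auto simp: dvd_def)
  have q_ge: "real q \<ge> real p powr c"
    using large \<open>p - 1 > 1\<close> by (simp add: largest_prime_factor_def q_def)
  have pc: "real p powr c > 0" using p2 by simp
  have "real m * real p powr c \<le> real m * real q" using q_ge by (intro mult_left_mono) auto
  also have "\<dots> = real (p - 1)" using m by (simp add: mult.commute)
  also have "\<dots> \<le> real p" by simp
  also have "\<dots> = real p powr (1 - c) * real p powr c" using p2 by (simp flip: powr_add)
  finally have "real m \<le> real p powr (1 - c)" using pc by simp
  also have "\<dots> \<le> x powr (1 - c)" using p c by (intro powr_mono2) auto
  finally have "real m \<le> x powr (1 - c)" .
  moreover have "m \<ge> 1" using m \<open>p - 1 > 1\<close> by (cases m) auto
  moreover have "p = m * q + 1" using m p2 by (simp add: mult.commute)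
  ultimately show ?thesis using q(1) by blast
qed

text \<open>A union bound over the cofactor \<open>m\<close>; counting a prime for several
  \<open>m\<close> only weakens it. The sieve parameter \<open>Y\<close> stays free, to be balanced
  against \<open>x\<close> later. The constant 8 is 2 from the prime pairs times 4 from the average
  of \<open>sing_weight\<close>.\<close>

lemma shifted_prime_count_le:
  assumes c: "0 < c" "c < 1" and x: "x \<ge> 1" and Y: "Y \<ge> 2"
  shows "real (shifted_prime_count c x)
    \<le> 2 * x powr (1 - c) * real Y ^ 12 + 8 * x * (1 + (1 - c) * ln x) / (ln (real Y))\<^sup>2"
proof -
  define M where "M = nat \<lfloor>x powr (1 - c)\<rfloor>"
  define Q where "Q = (\<lambda>m. {q. prime q \<and> prime (m * q + 1) \<and> real (m * q) \<le> x})"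
  have xc: "x powr (1 - c) \<ge> 1" "x powr (1 - c) \<le> x"
    using x c powr_mono[of "1 - c" 1 x] by (auto intro: ge_one_powr_ge_zero)
  have M: "M \<ge> 1" "real M \<le> x powr (1 - c)" using xc by (auto simp: M_def le_nat_floor)
  have finQ: "finite (Q m)" if "m \<in> {1..M}" for m
  proof (rule finite_subset)
    show "Q m \<subseteq> {..nat \<lfloor>x\<rfloor>}"
    proof
      fix q assume "q \<in> Q m"
      then have "real (m * q) \<le> x" by (simp add: Q_def)
      moreover have "real q \<le> real (m * q)" using that by (intro of_nat_mono) simp
      ultimately show "q \<in> {..nat \<lfloor>x\<rfloor>}" by (simp add: le_nat_floor)
    qed
  qed simp
  have "{p. prime p \<and> real p \<le> x \<and> real (largest_prime_factor (p - 1)) \<ge> real p powr c}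
      \<subseteq> (\<Union>m\<in>{1..M}. (\<lambda>q. m * q + 1) ` Q m)"
  proof
    fix p assume "p \<in> {p. prime p \<and> real p \<le> x \<and> real (largest_prime_factor (p - 1)) \<ge> real p powr c}"
    then have p: "prime p" "real p \<le> x" "real (largest_prime_factor (p - 1)) \<ge> real p powr c" by auto
    obtain m q where mq: "m \<ge> 1" "real m \<le> x powr (1 - c)" "prime q" "p = m * q + 1"
      using shifted_prime_pairs[OF c p] by blast
    have "m \<in> {1..M}" using mq by (simp add: M_def le_nat_floor)
    moreover have "q \<in> Q m" using mq p by (simp add: Q_def)
    ultimately show "p \<in> (\<Union>m\<in>{1..M}. (\<lambda>q. m * q + 1) ` Q m)" using mq(4) by blast
  qed
  then have "shifted_prime_count c x \<le> card (\<Union>m\<in>{1..M}. (\<lambda>q. m * q + 1) ` Q m)"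
    unfolding shifted_prime_count_def using finQ by (intro card_mono) auto
  also have "\<dots> \<le> (\<Sum>m\<in>{1..M}. card ((\<lambda>q. m * q + 1) ` Q m))" by (intro card_UN_le) simp
  also have "\<dots> \<le> (\<Sum>m\<in>{1..M}. card (Q m))" using finQ by (intro sum_mono card_image_le)
  finally have "real (shifted_prime_count c x) \<le> (\<Sum>m\<in>{1..M}. real (card (Q m)))"
    unfolding of_nat_sum[symmetric] by (rule of_nat_mono)
  also have "\<dots> \<le> (\<Sum>m\<in>{1..M}. 2 * real Y ^ 12 + 2 * x / (ln (real Y))\<^sup>2 * (sing_weight m / real m))"
  proof (intro sum_mono)
    fix m assume "m \<in> {1..M}"
    then have "m \<ge> 1" "real m \<le> real M" by auto
    then show "real (card (Q m)) \<le> 2 * real Y ^ 12 + 2 * x / (ln (real Y))\<^sup>2 * (sing_weight m / real m)"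
      unfolding Q_def using xc M Y by (intro card_prime_pairs_le) auto
  qed
  also have "\<dots> = real M * (2 * real Y ^ 12) + 2 * x / (ln (real Y))\<^sup>2 * (\<Sum>m=1..M. sing_weight m / real m)"
    by (simp add: sum.distrib sum_distrib_left)
  also have "\<dots> \<le> x powr (1 - c) * (2 * real Y ^ 12) + 2 * x / (ln (real Y))\<^sup>2 * (4 * (1 + (1 - c) * ln x))"
  proof (intro add_mono mult_right_mono mult_left_mono)
    have "ln (real M) \<le> ln (x powr (1 - c))" using M by (subst ln_le_cancel_iff) auto
    also have "\<dots> = (1 - c) * ln x" using x by (simp add: ln_powr)
    finally show "(\<Sum>m=1..M. sing_weight m / real m) \<le> 4 * (1 + (1 - c) * ln x)"
      using sum_sing_weight_le[OF M(1)] by simp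
  qed (use M x in auto)
  finally show ?thesis by (simp add: mult_ac)
qed

text \<open>With \<open>Y\<close> the integer part of \<open>x powr (1 / 40)\<close>,
  \<open>Y ^ 12\<close> is at most \<open>x powr (3 / 10)\<close>. Halving the exponent absorbs the
  rounding, since \<open>t\<^sup>2 - 1 \<ge> t\<close> for \<open>t \<ge> 2\<close>, so
  \<open>ln Y \<ge> ln x / 80\<close>. The constant is \<open>204800 = 8 * 80\<^sup>2 * 4\<close>,
  the 4 coming from Chebyshev's bound.\<close>

lemma shifted_prime_ratio_le:
  assumes c: "0 < c" "c < 1" and x: "x powr (1 / 80) \<ge> 2" "x \<ge> 4"
  shows "real (shifted_prime_count c x) / real (prime_count x)
    \<le> 8 * x powr (1 - c) * x powr (3 / 10) * ln x / x + 204800 * (1 + (1 - c) * ln x) / ln x"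
proof -
  define Y where "Y = nat \<lfloor>x powr (1 / 40)\<rfloor>"
  define t where "t = x powr (1 / 80)"
  have t: "t \<ge> 2" using x by (simp add: t_def)
  have t2: "x powr (1 / 40) = t\<^sup>2"
    using x by (simp add: t_def power2_eq_square flip: powr_add)
  have Yt: "real Y \<ge> t"
  proof -
    have "2 * t \<le> t\<^sup>2" using t by (simp add: power2_eq_square)
    then have "t \<le> x powr (1 / 40) - 1" using t by (simp add: t2)
    then show ?thesis unfolding Y_def by linarith
  qed
  have Y2: "Y \<ge> 2" using Yt t by linarith
  have Yx: "real Y \<le> x powr (1 / 40)" by (simp add: Y_def)
  have lnx: "ln x > 0" using x by simp
  have Y12: "real Y ^ 12 \<le> x powr (3 / 10)"
  proof -
    have "real Y ^ 12 \<le> (x powr (1 / 40)) ^ 12" using Yx by (intro power_mono) auto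
    also have "\<dots> = x powr (3 / 10)" using x by (simp add: powr_powr flip: powr_realpow)
    finally show ?thesis .
  qed
  have lnY: "ln (real Y) \<ge> ln x / 80"
  proof -
    have "ln x / 80 = ln t" using x by (simp add: t_def ln_powr)
    also have "\<dots> \<le> ln (real Y)" using Yt t by (subst ln_le_cancel_iff) auto
    finally show ?thesis .
  qed
  have a: "8 * x * (1 + (1 - c) * ln x) \<ge> 0" using x c lnx by simp
  have "real (shifted_prime_count c x)
      \<le> 2 * x powr (1 - c) * real Y ^ 12 + 8 * x * (1 + (1 - c) * ln x) / (ln (real Y))\<^sup>2"
    using c x Y2 by (intro shifted_prime_count_le) auto
  also have "\<dots> \<le> 2 * x powr (1 - c) * x powr (3 / 10) + 8 * x * (1 + (1 - c) * ln x) / (ln x / 80)\<^sup>2"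
    using Y12 lnY lnx a by (intro add_mono mult_left_mono divide_left_mono power_mono mult_pos_pos zero_less_power) auto
  finally have T: "real (shifted_prime_count c x)
      \<le> 2 * x powr (1 - c) * x powr (3 / 10) + 8 * x * (1 + (1 - c) * ln x) / (ln x / 80)\<^sup>2" .
  have P: "real (prime_count x) \<ge> x / (4 * ln x)" using x by (intro prime_count_ge)
  have P0: "x / (4 * ln x) > 0" using x lnx by simp
  have "real (shifted_prime_count c x) / real (prime_count x)
      \<le> real (shifted_prime_count c x) / (x / (4 * ln x))"
    using P P0 by (intro divide_left_mono mult_pos_pos) auto
  also have "\<dots> \<le> (2 * x powr (1 - c) * x powr (3 / 10) + 8 * x * (1 + (1 - c) * ln x) / (ln x / 80)\<^sup>2) / (x / (4 * ln x))"
    using T P0 by (intro divide_right_mono) auto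
  also have "\<dots> = 8 * x powr (1 - c) * x powr (3 / 10) * ln x / x + 204800 * (1 + (1 - c) * ln x) / ln x"
  proof -
    have "(2 * a * b + 8 * x * B / (L / 80)\<^sup>2) / (x / (4 * L)) = 8 * a * b * L / x + 204800 * B / L"
      if "L > 0" for a b B L :: real
      using that x by (simp add: field_simps power2_eq_square)
    then show ?thesis using lnx .
  qed
  finally show ?thesis .
qed

theorem theorem1:
  shows "\<exists>c::real. 0 < c \<and> c < 1 \<and>
    Limsup at_top
      (\<lambda>x::real. ereal (real (shifted_prime_count c x) / real (prime_count x))) < ereal (1 / 2)"
proof -
  \<comment> \<open>The bound below tends to \<open>204800 * (1 - c)\<close>.\<close>
  define c :: real where "c = 1 - 1 / 1000000"
  have c: "0 < c" "c < 1" and c1: "1 - c = 1 / 1000000" by (auto simp: c_def)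
  have "((\<lambda>x::real. 8 * x powr (1 / 1000000) * x powr (3 / 10) * ln x / x
      + 204800 * (1 + 1 / 1000000 * ln x) / ln x) \<longlongrightarrow> 204800 / 1000000) at_top"
    by real_asymp
  then have "eventually (\<lambda>x::real. 8 * x powr (1 / 1000000) * x powr (3 / 10) * ln x / x
      + 204800 * (1 + 1 / 1000000 * ln x) / ln x < 1 / 4) at_top"
    by (rule order_tendstoD) simp
  moreover have "eventually (\<lambda>x::real. x powr (1 / 80) \<ge> 2) at_top" by real_asymp
  ultimately have "eventually (\<lambda>x. ereal (real (shifted_prime_count c x) / real (prime_count x)) \<le> ereal (1 / 4)) at_top"
    using eventually_ge_at_top[of "4::real"]
  proof eventually_elim
    case (elim x)
    have "real (shifted_prime_count c x) / real (prime_count x) \<le> 1 / 4"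
      using shifted_prime_ratio_le[OF c elim(2,3)] elim(1) unfolding c1 by linarith
    then show ?case by simp
  qed
  \<comment> \<open>Only a non-strict bound passes to the upper limit; 1/4 lies between the limit
    0.2048 of the majorant and 1/2.\<close>
  then have "Limsup at_top (\<lambda>x::real. ereal (real (shifted_prime_count c x) / real (prime_count x))) \<le> ereal (1 / 4)"
    by (rule Limsup_bounded)
  also have "\<dots> < ereal (1 / 2)" by simp
  finally show ?thesis using c by blast
qed

end
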